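(* Let $G$ be a distributed system over a finite directed graph $\mathcal{G}(V,E)$ given by a balanced realization $(A^{(k)}(t),B^{(k)}(t),C^{(k)}(t),D^{(k)}(t))$ with balanced generalized gramians $\Sigma^{(k)}(t)=\mathrm{diag}(\Gamma^{(k)}(t),\Omega^{(k)}(t))$ and $\Sigma^{(ij)}(t)=\mathrm{diag}(\Gamma^{(ij)}(t),\Omega^{(ij)}(t))$, and let $G_r$ be the reduced order system obtained by balanced truncation of the states corresponding to the blocks $\Omega^{(k)}(t)$, $\Omega^{(ij)}(t)$. If $\Omega^{(k)}(t)=I$ and $\Omega^{(ij)}(t)=I$ for all $(t,k)\in\mathbb{N}_0\times V$ and $(i,j)\in E$ (where any of these blocks may have dimension zero, in which case the condition on it is vacuous), then $$\|G-G_r\|<2 .$$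
   Context: **Systems.** $\mathcal{G}(V,E)$ is a finite directed graph with $V=\{1,\dots,N\}$. For $k\in V$, $E_{\mathrm{in}}^{(k)}=\{i\in V\mid (i,k)\in E\}$ and $E_{\mathrm{out}}^{(k)}=\{j\in V\mid (k,j)\in E\}$, both ordered increasingly. A distributed system $G$ has, for each $k\in V$ and $t\in\mathbb{N}_0$, a temporal state $x^{(k)}(t)\in\mathbb{R}^{n^{(k)}(t)}$, input $u^{(k)}(t)\in\mathbb{R}^{n_u^{(k)}(t)}$, output $y^{(k)}(t)\in\mathbb{R}^{n_y^{(k)}(t)}$, and for each edge $(i,j)\in E$ a spatial state $x^{(ij)}(t)\in\mathbb{R}^{n^{(ij)}(t)}$ (all dimensions may vary with time and may be zero). Let $x_{\mathrm{in}}^{(k)}(t)$ be the vertical concatenation of $x^{(ik)}(t)$, $i\in E_{\mathrm{in}}^{(k)}$, and $x_{\mathrm{out}}^{(k)}(t)$ the vertical concatenation of $x^{(kj)}(t)$, $j\in E_{\mathrm{out}}^{(k)}$. The dynamics are, with $x^{(k)}(0)=0$, $x_{\mathrm{in}}^{(k)}(0)=0$, for all $(t,k)\in\mathbb{N}_0\times V$, $$\begin{bmatrix} x^{(k)}(t+1) \\ x_{\mathrm{out}}^{(k)}(t+1)\end{bmatrix}=A^{(k)}(t)\begin{bmatrix} x^{(k)}(t) \\ x_{\mathrm{in}}^{(k)}(t)\end{bmatrix}+B^{(k)}(t)u^{(k)}(t),\qquad y^{(k)}(t)=C^{(k)}(t)\begin{bmatrix} x^{(k)}(t) \\ x_{\mathrm{in}}^{(k)}(t)\end{bmatrix}+D^{(k)}(t)u^{(k)}(t),$$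 where the matrices are uniformly bounded in $t$. The quadruple $(A^{(k)}(t),B^{(k)}(t),C^{(k)}(t),D^{(k)}(t))$ is the realization of $G$. For a family $Z^{(ij)}(t)$ of matrices indexed by edges, $Z_{\mathrm{in}}^{(k)}(t)=\mathrm{diag}(Z^{(ik)}(t))_{i\in E_{\mathrm{in}}^{(k)}}$ and $Z_{\mathrm{out}}^{(k)}(t)=\mathrm{diag}(Z^{(kj)}(t))_{j\in E_{\mathrm{out}}^{(k)}}$ (block-diagonal). **Balanced realization.** The realization is balanced if there exist $\beta>0$ and uniformly bounded diagonal positive definite matrices $\Sigma^{(k)}(t)\succ\beta I$ (size $n^{(k)}(t)$), $\Sigma^{(ij)}(t)\succ\beta I$ (size $n^{(ij)}(t)$), called balanced generalized gramians, such that for all $(t,k)\in\mathbb{N}_0\times V$ $$A^{(k)}(t)\,\mathrm{diag}(\Sigma^{(k)}(t),\Sigma_{\mathrm{in}}^{(k)}(t))A^{(k)}(t)^T-\mathrm{diag}(\Sigma^{(k)}(t+1),\Sigma_{\mathrm{out}}^{(k)}(t+1))+B^{(k)}(t)B^{(k)}(t)^T\prec-\beta I,$$ $$A^{(k)}(t)^T\mathrm{diag}(\Sigma^{(k)}(t+1),\Sigma_{\mathrm{out}}^{(k)}(t+1))A^{(k)}(t)-\mathrm{diag}(\Sigma^{(k)}(t),\Sigma_{\mathrm{in}}^{(k)}(t))+C^{(k)}(t)^TC^{(k)}(t)\prec-\beta I.$$ The diagonal entries of each gramian are assumed ordered in a decreasing fashion. **Balanced truncation.** Given integers $0\le r^{(k)}(t)\le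 n^{(k)}(t)$ and $0\le r^{(ij)}(t)\le n^{(ij)}(t)$, write $\Sigma^{(k)}(t)=\mathrm{diag}(\Gamma^{(k)}(t),\Omega^{(k)}(t))$ and $\Sigma^{(ij)}(t)=\mathrm{diag}(\Gamma^{(ij)}(t),\Omega^{(ij)}(t))$ with $\Gamma^{(k)}(t)$ of size $r^{(k)}(t)$ and $\Gamma^{(ij)}(t)$ of size $r^{(ij)}(t)$ (blocks may have size zero). The reduced order system $G_r$, over the same graph, has temporal states of dimension $r^{(k)}(t)$, spatial states of dimension $r^{(ij)}(t)$, and realization $(A_r^{(k)}(t),B_r^{(k)}(t),C_r^{(k)}(t),D^{(k)}(t))$ obtained from that of $G$ by keeping, at each time, only the rows and columns corresponding to the first $r^{(k)}(t)$ components of each $x^{(k)}(t)$ and the first $r^{(ij)}(t)$ components of each $x^{(ij)}(t)$ (rows of $A^{(k)}(t)$, $B^{(k)}(t)$ according to the states at time $t+1$; columns of $A^{(k)}(t)$, $C^{(k)}(t)$ according to the states at time $t$). **Norm.** $\ell_2$ is the space of $w=(w^{(k)}(t))$ with $\|w\|_2=(\sum_{(t,k)}w^{(k)}(t)^Tw^{(k)}(t))^{1/2}<\infty$. For a system mapping $u\in\ell_2$ to $y\in\ell_2$ (from zero initial conditions), $\|G\|=\sup_{0\ne u\in\ell_2}\|y\|_2/\|u\|_2$. $G-G_r$ denotes the error system mapping $u$ to the difference of the outputs of $G$ and $G_r$. *)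

theory Defs
  imports
    "HOL-Analysis.Infinite_Sum"
    "Jordan_Normal_Form.Matrix"
    "Jordan_Normal_Form.DL_Submatrix"
begin

section \<open>Distributed systems over a finite directed graph\<close>

text \<open>Vertices are \<open>1, ..., nverts\<close>.  Everything indexed by a vertex \<open>k\<close> and a time \<open>t\<close> is a
  curried function \<open>k t\<close>; everything indexed by an edge \<open>(i, j)\<close> takes the pair and then the time.
  Values at non-vertices and non-edges are never constrained and never used.\<close>

record dsys =
  nverts :: nat
  edges :: "(nat \<times> nat) set"
  tdim :: "nat \<Rightarrow> nat \<Rightarrow> nat"
  sdim :: "nat \<times> nat \<Rightarrow> nat \<Rightarrow> nat"
  udim :: "nat \<Rightarrow> nat \<Rightarrow> nat"
  ydim :: "nat \<Rightarrow> nat \<Rightarrow> nat"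
  Amat :: "nat \<Rightarrow> nat \<Rightarrow> real mat"
  Bmat :: "nat \<Rightarrow> nat \<Rightarrow> real mat"
  Cmat :: "nat \<Rightarrow> nat \<Rightarrow> real mat"
  Dmat :: "nat \<Rightarrow> nat \<Rightarrow> real mat"

definition verts :: "dsys \<Rightarrow> nat set" where
  "verts G = {1..nverts G}"

definition in_list :: "dsys \<Rightarrow> nat \<Rightarrow> nat list" where
  "in_list G k = sorted_list_of_set {i \<in> verts G. (i, k) \<in> edges G}"

definition out_list :: "dsys \<Rightarrow> nat \<Rightarrow> nat list" where
  "out_list G k = sorted_list_of_set {j \<in> verts G. (k, j) \<in> edges G}"

text \<open>The block lists \<open>[X\<^sup>k, X\<^sup>i\<^sup>k for i in E_in k]\<close> and \<open>[X\<^sup>k, X\<^sup>k\<^sup>j for j in E_out k]\<close> at time \<open>t\<close>.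
  They are used for states (stacked vertically), for gramians (as diagonal blocks), and for
  dimensions, so that all three are laid out in the same order.\<close>

definition in_blocks ::
  "dsys \<Rightarrow> (nat \<Rightarrow> nat \<Rightarrow> 'b) \<Rightarrow> (nat \<times> nat \<Rightarrow> nat \<Rightarrow> 'b) \<Rightarrow> nat \<Rightarrow> nat \<Rightarrow> 'b list" where
  "in_blocks G X Z k t = X k t # map (\<lambda>i. Z (i, k) t) (in_list G k)"

definition out_blocks ::
  "dsys \<Rightarrow> (nat \<Rightarrow> nat \<Rightarrow> 'b) \<Rightarrow> (nat \<times> nat \<Rightarrow> nat \<Rightarrow> 'b) \<Rightarrow> nat \<Rightarrow> nat \<Rightarrow> 'b list" where
  "out_blocks G X Z k t = X k t # map (\<lambda>j. Z (k, j) t) (out_list G k)"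

definition vconcat :: "real vec list \<Rightarrow> real vec" where
  "vconcat vs = foldr (@\<^sub>v) vs (0\<^sub>v 0)"

abbreviation in_dim :: "dsys \<Rightarrow> nat \<Rightarrow> nat \<Rightarrow> nat" where
  "in_dim G k t \<equiv> sum_list (in_blocks G (tdim G) (sdim G) k t)"

abbreviation out_dim :: "dsys \<Rightarrow> nat \<Rightarrow> nat \<Rightarrow> nat" where
  "out_dim G k t \<equiv> sum_list (out_blocks G (tdim G) (sdim G) k t)"

definition vnorm :: "real vec \<Rightarrow> real" where
  "vnorm v = sqrt (scalar_prod v v)"

text \<open>Uniform boundedness in the induced (Euclidean) operator norm.  An entrywise bound would not
  be the same thing, because the dimensions may be unbounded in time.\<close>

definition unif_bounded :: "(nat \<Rightarrow> real mat) \<Rightarrow> bool" where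
  "unif_bounded F \<longleftrightarrow>
     (\<exists>M. \<forall>t. \<forall>v \<in> carrier_vec (dim_col (F t)). vnorm (F t *\<^sub>v v) \<le> M * vnorm v)"

definition dims_ok :: "dsys \<Rightarrow> bool" where
  "dims_ok G \<longleftrightarrow>
     edges G \<subseteq> verts G \<times> verts G \<and>
     (\<forall>k \<in> verts G. \<forall>t.
        Amat G k t \<in> carrier_mat (out_dim G k (t + 1)) (in_dim G k t) \<and>
        Bmat G k t \<in> carrier_mat (out_dim G k (t + 1)) (udim G k t) \<and>
        Cmat G k t \<in> carrier_mat (ydim G k t) (in_dim G k t) \<and>
        Dmat G k t \<in> carrier_mat (ydim G k t) (udim G k t))"

definition distributed_system :: "dsys \<Rightarrow> bool" where
  "distributed_system G \<longleftrightarrow> dims_ok G \<and>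
     (\<forall>k \<in> verts G. unif_bounded (Amat G k) \<and> unif_bounded (Bmat G k) \<and>
        unif_bounded (Cmat G k) \<and> unif_bounded (Dmat G k))"

type_synonym signal = "nat \<Rightarrow> nat \<Rightarrow> real vec"

definition signals :: "nat set \<Rightarrow> (nat \<Rightarrow> nat \<Rightarrow> nat) \<Rightarrow> signal set" where
  "signals V d = {w. \<forall>k \<in> V. \<forall>t. w k t \<in> carrier_vec (d k t)}"

definition trajectory ::
  "dsys \<Rightarrow> signal \<Rightarrow> signal \<Rightarrow> (nat \<times> nat \<Rightarrow> nat \<Rightarrow> real vec) \<Rightarrow> signal \<Rightarrow> bool" where
  "trajectory G u xT xS y \<longleftrightarrow>
     (\<forall>k \<in> verts G. \<forall>t. xT k t \<in> carrier_vec (tdim G k t)) \<and>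
     (\<forall>e \<in> edges G. \<forall>t. xS e t \<in> carrier_vec (sdim G e t)) \<and>
     (\<forall>k \<in> verts G. xT k 0 = 0\<^sub>v (tdim G k 0)) \<and>
     (\<forall>e \<in> edges G. xS e 0 = 0\<^sub>v (sdim G e 0)) \<and>
     (\<forall>k \<in> verts G. \<forall>t.
        vconcat (out_blocks G xT xS k (t + 1)) =
          Amat G k t *\<^sub>v vconcat (in_blocks G xT xS k t) + Bmat G k t *\<^sub>v u k t \<and>
        y k t = Cmat G k t *\<^sub>v vconcat (in_blocks G xT xS k t) + Dmat G k t *\<^sub>v u k t)"

text \<open>A system is identified with its graph as an input-output map.  The lemmas
  \<open>trajectory_exists\<close> and \<open>trajectory_unique\<close> below show that it is one: every input has a
  trajectory, and the output at the vertices is determined by the input.\<close>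

definition io_map :: "dsys \<Rightarrow> (signal \<times> signal) set" where
  "io_map G = {(u, y). u \<in> signals (verts G) (udim G) \<and> (\<exists>xT xS. trajectory G u xT xS y)}"

definition error_map :: "dsys \<Rightarrow> dsys \<Rightarrow> (signal \<times> signal) set" where
  "error_map G H =
     {(u, \<lambda>k t. y k t - z k t) | u y z. (u, y) \<in> io_map G \<and> (u, z) \<in> io_map H}"

section \<open>The induced norm\<close>

definition l2norm :: "nat set \<Rightarrow> signal \<Rightarrow> ennreal" where
  "l2norm V w =
     (if (\<lambda>(t, k). scalar_prod (w k t) (w k t)) summable_on UNIV \<times> V
      then ennreal (sqrt (\<Sum>\<^sub>\<infinity>(t, k) \<in> UNIV \<times> V. scalar_prod (w k t) (w k t)))
      else \<infinity>)"

definition ell2 :: "nat set \<Rightarrow> (nat \<Rightarrow> nat \<Rightarrow> nat) \<Rightarrow> signal set" where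
  "ell2 V d = {w \<in> signals V d. l2norm V w < \<infinity>}"

text \<open>An output outside \<open>ell2\<close> has infinite norm, so a finite value of \<open>sys_norm\<close> entails that the
  system maps \<open>ell2\<close> into \<open>ell2\<close>.\<close>

definition sys_norm ::
  "nat set \<Rightarrow> (nat \<Rightarrow> nat \<Rightarrow> nat) \<Rightarrow> (signal \<times> signal) set \<Rightarrow> ennreal" where
  "sys_norm V d S =
     (SUP (u, y) \<in> {(u, y) \<in> S. u \<in> ell2 V d \<and> (\<exists>k \<in> V. \<exists>t. u k t \<noteq> 0\<^sub>v (d k t))}.
        l2norm V y / l2norm V u)"

section \<open>Balanced realizations\<close>

definition pos_def :: "real mat \<Rightarrow> bool" where
  "pos_def M \<longleftrightarrow> M \<in> carrier_mat (dim_row M) (dim_row M) \<and> transpose_mat M = M \<and>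
     (\<forall>v \<in> carrier_vec (dim_row M). v \<noteq> 0\<^sub>v (dim_row M) \<longrightarrow> scalar_prod v (M *\<^sub>v v) > 0)"

definition loewner_less :: "real mat \<Rightarrow> real mat \<Rightarrow> bool" (infix \<open>\<prec>\<^sub>L\<close> 50) where
  "A \<prec>\<^sub>L B \<longleftrightarrow> dim_row A = dim_row B \<and> dim_col A = dim_col B \<and> pos_def (B - A)"

definition decreasing_diag :: "real mat \<Rightarrow> bool" where
  "decreasing_diag M \<longleftrightarrow> (\<forall>i j. i \<le> j \<longrightarrow> j < dim_row M \<longrightarrow> M $$ (j, j) \<le> M $$ (i, i))"

definition balanced_gramians ::
  "dsys \<Rightarrow> (nat \<Rightarrow> nat \<Rightarrow> real mat) \<Rightarrow> (nat \<times> nat \<Rightarrow> nat \<Rightarrow> real mat) \<Rightarrow> bool" where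
  "balanced_gramians G ST SS \<longleftrightarrow> (\<exists>\<beta>>0.
     (\<forall>k \<in> verts G. \<forall>t. ST k t \<in> carrier_mat (tdim G k t) (tdim G k t) \<and>
        diagonal_mat (ST k t) \<and> decreasing_diag (ST k t) \<and>
        \<beta> \<cdot>\<^sub>m 1\<^sub>m (tdim G k t) \<prec>\<^sub>L ST k t) \<and>
     (\<forall>e \<in> edges G. \<forall>t. SS e t \<in> carrier_mat (sdim G e t) (sdim G e t) \<and>
        diagonal_mat (SS e t) \<and> decreasing_diag (SS e t) \<and>
        \<beta> \<cdot>\<^sub>m 1\<^sub>m (sdim G e t) \<prec>\<^sub>L SS e t) \<and>
     (\<forall>k \<in> verts G. unif_bounded (ST k)) \<and>
     (\<forall>e \<in> edges G. unif_bounded (SS e)) \<and>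
     (\<forall>k \<in> verts G. \<forall>t.
        Amat G k t * diag_block_mat (in_blocks G ST SS k t) * transpose_mat (Amat G k t)
          - diag_block_mat (out_blocks G ST SS k (t + 1))
          + Bmat G k t * transpose_mat (Bmat G k t)
        \<prec>\<^sub>L (- \<beta>) \<cdot>\<^sub>m 1\<^sub>m (out_dim G k (t + 1)) \<and>
        transpose_mat (Amat G k t) * diag_block_mat (out_blocks G ST SS k (t + 1)) * Amat G k t
          - diag_block_mat (in_blocks G ST SS k t)
          + transpose_mat (Cmat G k t) * Cmat G k t
        \<prec>\<^sub>L (- \<beta>) \<cdot>\<^sub>m 1\<^sub>m (in_dim G k t)))"

section \<open>Truncation\<close>

text \<open>For consecutive index blocks of sizes \<open>n\<close>, the indices lying among the first \<open>r\<close> of their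
  block; the argument lists the pairs \<open>(n, r)\<close>.\<close>

fun kept :: "(nat \<times> nat) list \<Rightarrow> nat set" where
  "kept [] = {}"
| "kept ((n, r) # bs) = {..<r} \<union> (+) n ` kept bs"

definition truncate_sys ::
  "dsys \<Rightarrow> (nat \<Rightarrow> nat \<Rightarrow> nat) \<Rightarrow> (nat \<times> nat \<Rightarrow> nat \<Rightarrow> nat) \<Rightarrow> dsys" where
  "truncate_sys G rT rS =
     (let I = \<lambda>k t. kept (zip (in_blocks G (tdim G) (sdim G) k t) (in_blocks G rT rS k t));
          J = \<lambda>k t. kept (zip (out_blocks G (tdim G) (sdim G) k t) (out_blocks G rT rS k t))
      in G\<lparr>tdim := rT, sdim := rS,
           Amat := \<lambda>k t. submatrix (Amat G k t) (J k (t + 1)) (I k t),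
           Bmat := \<lambda>k t. submatrix (Bmat G k t) (J k (t + 1)) UNIV,
           Cmat := \<lambda>k t. submatrix (Cmat G k t) UNIV (I k t)\<rparr>)"

section \<open>Existence and uniqueness of trajectories\<close>

lemma vconcat_Cons: "vconcat (v # vs) = v @\<^sub>v vconcat vs"
  by (simp add: vconcat_def)

lemma vconcat_carrier:
  "list_all2 (\<lambda>v d. v \<in> carrier_vec d) vs ds \<Longrightarrow> vconcat vs \<in> carrier_vec (sum_list ds)"
proof (induction rule: list_all2_induct)
  case Nil
  show ?case unfolding vconcat_def foldr.simps id_apply sum_list.Nil by (rule zero_carrier_vec)
next
  case (Cons v vs d ds)
  then show ?case unfolding vconcat_Cons sum_list.Cons by (intro append_carrier_vec)
qed

lemma vconcat_split:
  "v \<in> carrier_vec (sum_list ds) \<Longrightarrow>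
   \<exists>vs. list_all2 (\<lambda>v d. v \<in> carrier_vec d) vs ds \<and> vconcat vs = v"
proof (induction ds arbitrary: v)
  case Nil
  then show ?case by (auto simp: vconcat_def intro: eq_vecI)
next
  case (Cons d ds)
  from Cons.prems have v: "vec_first v d @\<^sub>v vec_last v (sum_list ds) = v" by simp
  obtain vs where "list_all2 (\<lambda>v d. v \<in> carrier_vec d) vs ds" "vconcat vs = vec_last v (sum_list ds)"
    using Cons.IH[OF vec_last_carrier] by blast
  then show ?case
    using v by (intro exI[of _ "vec_first v d # vs"]) (simp add: vconcat_Cons)
qed

lemma vconcat_inj:
  assumes "list_all2 (\<lambda>v d. v \<in> carrier_vec d) vs ds" "list_all2 (\<lambda>v d. v \<in> carrier_vec d) ws ds"
    "vconcat vs = vconcat ws"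
  shows "vs = ws"
  using assms
proof (induction vs ds arbitrary: ws rule: list_all2_induct)
  case Nil
  then show ?case by simp
next
  case (Cons v vs d ds)
  from Cons.prems obtain w ws' where "ws = w # ws'" "w \<in> carrier_vec d"
    "list_all2 (\<lambda>v d. v \<in> carrier_vec d) ws' ds" by (auto simp: list_all2_Cons2)
  note ws = this
  have "v @\<^sub>v vconcat vs = w @\<^sub>v vconcat ws'"
    using Cons.prems(2) unfolding ws(1) vconcat_Cons .
  then have "v = w" "vconcat vs = vconcat ws'"
    using append_vec_eq[OF Cons.hyps(1) ws(2)] by blast+
  with Cons.IH[OF ws(3)] ws(1) show ?case by blast
qed

lemma set_in_list: "set (in_list G k) = {i \<in> verts G. (i, k) \<in> edges G}"
  by (simp add: in_list_def verts_def)

lemma set_out_list: "set (out_list G k) = {j \<in> verts G. (k, j) \<in> edges G}"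
  by (simp add: out_list_def verts_def)

lemma distinct_out_list: "distinct (out_list G k)"
  by (simp add: out_list_def)

lemma in_blocks_carrier:
  assumes "k \<in> verts G" "\<forall>k \<in> verts G. xT k t \<in> carrier_vec (tdim G k t)"
    "\<forall>e \<in> edges G. xS e t \<in> carrier_vec (sdim G e t)"
  shows "list_all2 (\<lambda>v d. v \<in> carrier_vec d) (in_blocks G xT xS k t)
           (in_blocks G (tdim G) (sdim G) k t)"
  using assms by (auto simp: in_blocks_def list.rel_map set_in_list intro!: list.rel_refl_strong)

lemma out_blocks_carrier:
  assumes "k \<in> verts G" "\<forall>k \<in> verts G. xT k t \<in> carrier_vec (tdim G k t)"
    "\<forall>e \<in> edges G. xS e t \<in> carrier_vec (sdim G e t)"
  shows "list_all2 (\<lambda>v d. v \<in> carrier_vec d) (out_blocks G xT xS k t)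
           (out_blocks G (tdim G) (sdim G) k t)"
  using assms by (auto simp: out_blocks_def list.rel_map set_out_list intro!: list.rel_refl_strong)

lemma out_blocks_surj:
  assumes E: "edges G \<subseteq> verts G \<times> verts G"
    and X: "\<And>k. k \<in> verts G \<Longrightarrow> X k \<in> carrier_vec (out_dim G k t)"
  shows "\<exists>xT xS. (\<forall>k \<in> verts G. xT k \<in> carrier_vec (tdim G k t)) \<and>
           (\<forall>e \<in> edges G. xS e \<in> carrier_vec (sdim G e t)) \<and>
           (\<forall>k \<in> verts G. vconcat (xT k # map (\<lambda>j. xS (k, j)) (out_list G k)) = X k)"
proof -
  have "\<exists>vs. list_all2 (\<lambda>v d. v \<in> carrier_vec d) vs (out_blocks G (tdim G) (sdim G) k t)
          \<and> vconcat vs = X k" if "k \<in> verts G" for k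
    using vconcat_split[OF X[OF that]] .
  then obtain W where W: "\<And>k. k \<in> verts G \<Longrightarrow>
      list_all2 (\<lambda>v d. v \<in> carrier_vec d) (W k) (out_blocks G (tdim G) (sdim G) k t)
      \<and> vconcat (W k) = X k" by metis
  define xT where "xT k = hd (W k)" for k
  define xS where "xS = (\<lambda>(k, j). the (map_of (zip (out_list G k) (tl (W k))) j))"
  have len: "length (tl (W k)) = length (out_list G k)" if "k \<in> verts G" for k
    using W[OF that] by (auto dest!: list_all2_lengthD simp: out_blocks_def)
  have nth: "xS (k, out_list G k ! n) = tl (W k) ! n"
    if "k \<in> verts G" "n < length (out_list G k)" for k n
    using that len[of k] by (simp add: xS_def map_of_zip_nth distinct_out_list)
  have Wk: "xT k # map (\<lambda>j. xS (k, j)) (out_list G k) = W k" if "k \<in> verts G" for k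
  proof -
    have "map (\<lambda>j. xS (k, j)) (out_list G k) = tl (W k)"
      using nth[OF that] len[OF that] by (intro nth_equalityI) auto
    moreover have "W k \<noteq> []" using W[OF that] by (auto simp: out_blocks_def)
    ultimately show ?thesis by (simp add: xT_def)
  qed
  have c: "xT k \<in> carrier_vec (tdim G k t) \<and>
      list_all2 (\<lambda>v d. v \<in> carrier_vec d) (map (\<lambda>j. xS (k, j)) (out_list G k))
        (map (\<lambda>j. sdim G (k, j) t) (out_list G k))" if "k \<in> verts G" for k
    using W[OF that] Wk[OF that, symmetric] by (simp add: out_blocks_def)
  have "xS (k, j) \<in> carrier_vec (sdim G (k, j) t)" if "(k, j) \<in> edges G" for k j
  proof -
    have k: "k \<in> verts G" and "j \<in> set (out_list G k)" using that E by (auto simp: set_out_list)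
    then obtain n where "n < length (out_list G k)" "j = out_list G k ! n"
      by (auto simp: in_set_conv_nth)
    with c[OF k] show ?thesis by (auto simp: list_all2_conv_all_nth)
  qed
  then show ?thesis using c Wk W by (intro exI[of _ xT] exI[of _ xS]) auto
qed

theorem trajectory_exists:
  assumes G: "dims_ok G" and u: "u \<in> signals (verts G) (udim G)"
  shows "\<exists>xT xS y. trajectory G u xT xS y"
proof -
  define P where "P t s \<longleftrightarrow>
      (\<forall>k \<in> verts G. fst s k \<in> carrier_vec (tdim G k t)) \<and>
      (\<forall>e \<in> edges G. snd s e \<in> carrier_vec (sdim G e t)) \<and>
      (t = 0 \<longrightarrow> s = (\<lambda>k. 0\<^sub>v (tdim G k 0), \<lambda>e. 0\<^sub>v (sdim G e 0)))"
    for t :: nat and s :: "(nat \<Rightarrow> real vec) \<times> (nat \<times> nat \<Rightarrow> real vec)"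
  define Q where "Q t s s' \<longleftrightarrow> (\<forall>k \<in> verts G.
      vconcat (fst s' k # map (\<lambda>j. snd s' (k, j)) (out_list G k)) =
        Amat G k t *\<^sub>v vconcat (fst s k # map (\<lambda>i. snd s (i, k)) (in_list G k))
        + Bmat G k t *\<^sub>v u k t)"
    for t :: nat and s s' :: "(nat \<Rightarrow> real vec) \<times> (nat \<times> nat \<Rightarrow> real vec)"
  have "\<exists>f. \<forall>t. P t (f t) \<and> Q t (f t) (f (Suc t))"
  proof (rule dependent_nat_choice)
    show "\<exists>s. P 0 s" by (simp add: P_def)
  next
    fix s t assume "P t s"
    define X where "X k = Amat G k t *\<^sub>v vconcat (fst s k # map (\<lambda>i. snd s (i, k)) (in_list G k))
        + Bmat G k t *\<^sub>v u k t" for k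
    have "X k \<in> carrier_vec (out_dim G k (Suc t))" if "k \<in> verts G" for k
    proof -
      have "Amat G k t \<in> carrier_mat (out_dim G k (Suc t)) (in_dim G k t)"
        "Bmat G k t \<in> carrier_mat (out_dim G k (Suc t)) (udim G k t)"
        using G that unfolding dims_ok_def Suc_eq_plus1 by blast+
      then show ?thesis unfolding X_def
        by (intro carrier_vecI) (simp only: index_add_vec dim_mult_mat_vec carrier_matD)
    qed
    from out_blocks_surj[OF _ this] G obtain xT xS where
      "\<forall>k \<in> verts G. xT k \<in> carrier_vec (tdim G k (Suc t))"
      "\<forall>e \<in> edges G. xS e \<in> carrier_vec (sdim G e (Suc t))"
      "\<forall>k \<in> verts G. vconcat (xT k # map (\<lambda>j. xS (k, j)) (out_list G k)) = X k"
      by (auto simp: dims_ok_def)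
    then show "\<exists>s'. P (Suc t) s' \<and> Q t s s'"
      by (intro exI[of _ "(xT, xS)"]) (simp add: P_def Q_def X_def)
  qed
  then obtain f where f: "\<And>t. P t (f t)" "\<And>t. Q t (f t) (f (Suc t))" by blast
  define xT where "xT k t = fst (f t) k" for k t
  define xS where "xS e t = snd (f t) e" for e t
  have "trajectory G u xT xS
      (\<lambda>k t. Cmat G k t *\<^sub>v vconcat (in_blocks G xT xS k t) + Dmat G k t *\<^sub>v u k t)"
    using f f(1)[of 0]
    by (simp add: trajectory_def P_def Q_def xT_def xS_def in_blocks_def out_blocks_def)
  then show ?thesis by blast
qed

theorem trajectory_unique:
  assumes G: "dims_ok G"
    and 1: "trajectory G u xT xS y" and 2: "trajectory G u xT' xS' y'" and k: "k \<in> verts G"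
  shows "y k t = y' k t"
proof -
  have E: "edges G \<subseteq> verts G \<times> verts G" using G by (simp add: dims_ok_def)
  have in_eq: "in_blocks G xT xS k t = in_blocks G xT' xS' k t"
    if "\<forall>k \<in> verts G. xT k t = xT' k t" "\<forall>e \<in> edges G. xS e t = xS' e t" "k \<in> verts G" for k t
    using that by (auto simp: in_blocks_def set_in_list)
  have st: "(\<forall>k \<in> verts G. xT k t = xT' k t) \<and> (\<forall>e \<in> edges G. xS e t = xS' e t)" for t
  proof (induction t)
    case 0
    then show ?case using 1 2 by (simp add: trajectory_def)
  next
    case (Suc t)
    have b: "out_blocks G xT xS k (Suc t) = out_blocks G xT' xS' k (Suc t)" if "k \<in> verts G" for k
    proof (rule vconcat_inj)
      show "list_all2 (\<lambda>v d. v \<in> carrier_vec d) (out_blocks G xT xS k (Suc t))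
           (out_blocks G (tdim G) (sdim G) k (Suc t))"
        using 1 that by (intro out_blocks_carrier) (auto simp: trajectory_def)
      show "list_all2 (\<lambda>v d. v \<in> carrier_vec d) (out_blocks G xT' xS' k (Suc t))
           (out_blocks G (tdim G) (sdim G) k (Suc t))"
        using 2 that by (intro out_blocks_carrier) (auto simp: trajectory_def)
      show "vconcat (out_blocks G xT xS k (Suc t)) = vconcat (out_blocks G xT' xS' k (Suc t))"
        using 1 2 that in_eq[OF conjunct1[OF Suc] conjunct2[OF Suc] that]
        by (simp add: trajectory_def)
    qed
    show ?case
    proof (intro conjI ballI)
      fix k assume "k \<in> verts G"
      then show "xT k (Suc t) = xT' k (Suc t)" using b by (simp add: out_blocks_def)
    next
      fix e assume e: "e \<in> edges G"
      obtain k j where kj: "e = (k, j)" by force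
      with e E have "k \<in> verts G" "j \<in> set (out_list G k)" by (auto simp: set_out_list)
      then show "xS e (Suc t) = xS' e (Suc t)" using b[of k] kj by (simp add: out_blocks_def)
    qed
  qed
  show ?thesis
    using 1 2 k in_eq[OF conjunct1[OF st] conjunct2[OF st] k] by (simp add: trajectory_def)
qed

text \<open>Truncation again yields a system with matching dimensions, so the two lemmas above also
  apply to the reduced order system.\<close>

lemma kept_less:
  "list_all2 (\<le>) rs ns \<Longrightarrow> kept (zip ns rs) \<subseteq> {..<sum_list ns}"
  by (induction rule: list_all2_induct) auto

lemma card_kept:
  "list_all2 (\<le>) rs ns \<Longrightarrow> card (kept (zip ns rs)) = sum_list rs"
proof (induction rule: list_all2_induct)
  case Nil
  then show ?case by simp
next
  case (Cons r rs n ns)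
  have "finite (kept (zip ns rs))"
    using kept_less[OF Cons(2)] finite_subset by blast
  moreover have "{..<r} \<inter> (+) n ` kept (zip ns rs) = {}" using Cons(1) by auto
  ultimately show ?case
    using Cons by (simp add: card_Un_disjoint card_image)
qed

lemma card_kept_less:
  assumes "list_all2 (\<le>) rs ns"
  shows "card {i. i < sum_list ns \<and> i \<in> kept (zip ns rs)} = sum_list rs"
proof -
  have "{i. i < sum_list ns \<and> i \<in> kept (zip ns rs)} = kept (zip ns rs)"
    using kept_less[OF assms] by auto
  then show ?thesis using card_kept[OF assms] by simp
qed

theorem dims_ok_truncate_sys:
  assumes G: "dims_ok G"
    and rT: "\<And>k t. k \<in> verts G \<Longrightarrow> rT k t \<le> tdim G k t"
    and rS: "\<And>e t. e \<in> edges G \<Longrightarrow> rS e t \<le> sdim G e t"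
  shows "dims_ok (truncate_sys G rT rS)"
proof -
  let ?H = "truncate_sys G rT rS"
  have H: "verts ?H = verts G" "edges ?H = edges G" "tdim ?H = rT" "sdim ?H = rS"
    "udim ?H = udim G" "ydim ?H = ydim G" "Dmat ?H = Dmat G"
    by (simp_all add: truncate_sys_def Let_def verts_def)
  have blocks: "in_blocks ?H rT rS = in_blocks G rT rS" "out_blocks ?H rT rS = out_blocks G rT rS"
    by (simp_all add: fun_eq_iff in_blocks_def out_blocks_def in_list_def out_list_def H)
  have le_in: "list_all2 (\<le>) (in_blocks G rT rS k t) (in_blocks G (tdim G) (sdim G) k t)"
    and le_out: "list_all2 (\<le>) (out_blocks G rT rS k t) (out_blocks G (tdim G) (sdim G) k t)"
    if "k \<in> verts G" for k t
    using that rT rS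
    by (auto simp: in_blocks_def out_blocks_def list.rel_map set_in_list set_out_list
        intro!: list.rel_refl_strong)
  note cards = card_kept_less[OF le_in] card_kept_less[OF le_out]
  show ?thesis
    unfolding dims_ok_def H blocks
  proof (intro conjI ballI allI)
    show "edges G \<subseteq> verts G \<times> verts G" using G by (simp add: dims_ok_def)
    fix k t assume k: "k \<in> verts G"
    have c: "Amat G k t \<in> carrier_mat (out_dim G k (t + 1)) (in_dim G k t)"
      "Bmat G k t \<in> carrier_mat (out_dim G k (t + 1)) (udim G k t)"
      "Cmat G k t \<in> carrier_mat (ydim G k t) (in_dim G k t)"
      "Dmat G k t \<in> carrier_mat (ydim G k t) (udim G k t)"
      using G k unfolding dims_ok_def by blast+
    show "Amat ?H k t \<in> carrier_mat (sum_list (out_blocks G rT rS k (t + 1)))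
        (sum_list (in_blocks G rT rS k t))"
      using carrier_matD[OF c(1)] cards[OF k]
      by (intro carrier_matI) (simp_all add: truncate_sys_def Let_def dim_submatrix)
    show "Bmat ?H k t \<in> carrier_mat (sum_list (out_blocks G rT rS k (t + 1))) (udim G k t)"
      using carrier_matD[OF c(2)] cards[OF k]
      by (intro carrier_matI) (simp_all add: truncate_sys_def Let_def dim_submatrix)
    show "Cmat ?H k t \<in> carrier_mat (ydim G k t) (sum_list (in_blocks G rT rS k t))"
      using carrier_matD[OF c(3)] cards[OF k]
      by (intro carrier_matI) (simp_all add: truncate_sys_def Let_def dim_submatrix)
    show "Dmat G k t \<in> carrier_mat (ydim G k t) (udim G k t)" by (fact c(4))
  qed
qed

end

(* Pad the reduced state with zeros to a vector z of the full dimension and compare it with the full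
   state x, where both systems have the same input u.  With e = x - z and s = x + z, the storage
   function V = e^T Sigma e + s^T Sigma^-1 s, summed over all vertices and edges, satisfies
     V(t+1) + |error|^2 <= V(t) + 4 (1 - beta/c) |u|^2,
   where c > beta bounds the gramians.  The truncated part w of the update of z enters e and s with
   opposite signs; since Sigma = I there, and e and s agree on the truncated components, its cross
   terms cancel.  The observability inequality controls e, the reachability inequality (in its
   dual form, by Young's inequality) controls s, and its margin beta gives the factor 1 - beta/c
   which makes the final bound strict. *)
theory Submission
  imports Defs
begin

section \<open>Dissipation inequality for a single update, component by component\<close>

text \<open>The quadratic form of the diagonal matrix with diagonal \<open>d\<close>. Gramians are
  carried as vectors of diagonal entries so that the estimates can be made entry by entry.\<close>

definition wsq :: "real vec \<Rightarrow> real vec \<Rightarrow> real" where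
  "wsq d v = (\<Sum>i<dim_vec d. d $ i * (v $ i)\<^sup>2)"

lemma scalar_prod_self: "(v :: real vec) \<bullet> v = (\<Sum>i<dim_vec v. (v $ i)\<^sup>2)"
  by (simp add: scalar_prod_def power2_eq_square lessThan_atLeast0)

text \<open>The share of one block in the function V, with \<open>d\<close> the diagonal of its
  gramian and \<open>z\<close> the padded reduced state.\<close>

definition storage :: "real vec \<Rightarrow> real vec \<Rightarrow> real vec \<Rightarrow> real" where
  "storage d x z = (\<Sum>i<dim_vec d. d $ i * (x $ i - z $ i)\<^sup>2 + (x $ i + z $ i)\<^sup>2 / d $ i)"

lemma reachability_bound:
  fixes A B :: "real mat"
  assumes A: "A \<in> carrier_mat n' n" and B: "B \<in> carrier_mat n' m"
    and d: "d \<in> carrier_vec n" "\<And>i. i < n \<Longrightarrow> 0 < d $ i"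
    and d': "d' \<in> carrier_vec n'" "\<And>i. i < n' \<Longrightarrow> 0 < d' $ i \<and> d' $ i \<le> c"
    and \<beta>: "0 < \<beta>" "\<beta> < c"
    and reach: "\<And>p. p \<in> carrier_vec n' \<Longrightarrow>
      wsq d (transpose_mat A *\<^sub>v p) + (transpose_mat B *\<^sub>v p) \<bullet> (transpose_mat B *\<^sub>v p) + \<beta> * (p \<bullet> p)
        \<le> wsq d' p"
    and s: "s \<in> carrier_vec n" and v: "v \<in> carrier_vec m"
  shows "(\<Sum>i<n'. ((A *\<^sub>v s + B *\<^sub>v v) $ i)\<^sup>2 / d' $ i)
    \<le> (1 - \<beta> / c) * ((\<Sum>i<n. (s $ i)\<^sup>2 / d $ i) + v \<bullet> v)"
proof -
  \<comment> \<open>With \<open>p = d'\<^sup>-\<^sup>1 b\<close>, the left-hand side is \<open>q = p \<bullet> b\<close>; Young's inequality with parameter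
    \<open>l = 1 - \<beta> / c\<close> and the assumption at \<open>p\<close> give \<open>2 q \<le> q + l r\<close>.\<close>
  define b where "b = A *\<^sub>v s + B *\<^sub>v v"
  define p where "p = vec n' (\<lambda>i. b $ i / d' $ i)"
  define q where "q = (\<Sum>i<n'. (b $ i)\<^sup>2 / d' $ i)"
  define a where "a = transpose_mat A *\<^sub>v p"
  define h where "h = transpose_mat B *\<^sub>v p"
  define l where "l = 1 - \<beta> / c"
  define r where "r = (\<Sum>i<n. (s $ i)\<^sup>2 / d $ i) + v \<bullet> v"
  have c: "c > 0" using \<beta> by simp
  have l: "l > 0" using \<beta> by (simp add: l_def)
  have bc: "b \<in> carrier_vec n'" and pc: "p \<in> carrier_vec n'"
    and ac: "a \<in> carrier_vec n" and hc: "h \<in> carrier_vec m"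
    using A B s v by (auto simp: b_def p_def a_def h_def)
  have "p \<bullet> b = q"
    using bc by (simp add: scalar_prod_def p_def q_def power2_eq_square lessThan_atLeast0)
  moreover have "p \<bullet> b = a \<bullet> s + h \<bullet> v"
    unfolding b_def a_def h_def
    using A B s v pc by (subst scalar_prod_add_distrib[of _ n']) (auto simp: transpose_vec_mult_scalar)
  ultimately have q1: "q = a \<bullet> s + h \<bullet> v" by simp
  have q2: "wsq d' p = q"
    using d' bc by (auto simp: wsq_def q_def p_def power2_eq_square intro!: sum.cong)
  \<comment> \<open>The upper bound \<open>c\<close> on the weights turns the margin
    \<open>\<beta> * (p \<bullet> p)\<close> of \<open>reach\<close> into the fraction
    \<open>\<beta> / c\<close> of \<open>q\<close>; this is the origin of the factor
    \<open>l\<close>.\<close>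
  have "q \<le> c * (p \<bullet> p)"
  proof -
    have "(b $ i)\<^sup>2 / d' $ i \<le> c * (b $ i / d' $ i)\<^sup>2" if "i < n'" for i
    proof -
      have "d' $ i * (b $ i / d' $ i)\<^sup>2 \<le> c * (b $ i / d' $ i)\<^sup>2"
        using d'(2)[OF that] by (intro mult_right_mono) auto
      moreover have "d' $ i * (b $ i / d' $ i)\<^sup>2 = (b $ i)\<^sup>2 / d' $ i"
        using d'(2)[OF that] by (simp add: power2_eq_square)
      ultimately show ?thesis by simp
    qed
    then show ?thesis
      unfolding q_def scalar_prod_self sum_distrib_left using pc by (auto simp: p_def intro!: sum_mono)
  qed
  then have "\<beta> / c * q \<le> \<beta> * (p \<bullet> p)" using \<beta> c by (simp add: field_simps)
  with reach[OF pc] q2 have q3: "wsq d a + h \<bullet> h \<le> l * q"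
    by (simp add: a_def h_def l_def algebra_simps)
  \<comment> \<open>Applied in each component, with weight \<open>g = d $ i\<close> for the state
    part and \<open>g = 1\<close> for the input part.\<close>
  have young: "2 * (x * y) \<le> g * x\<^sup>2 / l + l * (y\<^sup>2 / g)" if "g > 0" for x y g :: real
  proof -
    have "0 \<le> (g * x - l * y)\<^sup>2 / (g * l)" using that l by simp
    also have "\<dots> = g * x\<^sup>2 / l + l * (y\<^sup>2 / g) - 2 * (x * y)"
      using that l by (simp add: field_simps power2_eq_square)
    finally show ?thesis by simp
  qed
  have "2 * (a \<bullet> s) \<le> wsq d a / l + l * (\<Sum>i<n. (s $ i)\<^sup>2 / d $ i)"
    unfolding wsq_def scalar_prod_def sum_distrib_left sum_divide_distrib
    using s d young by (auto simp: lessThan_atLeast0 simp flip: sum.distrib intro!: sum_mono)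
  moreover have "2 * (h \<bullet> v) \<le> (h \<bullet> h) / l + l * (v \<bullet> v)"
    unfolding scalar_prod_self unfolding scalar_prod_def sum_distrib_left sum_divide_distrib
    using v hc young[of 1] by (auto simp: lessThan_atLeast0 simp flip: sum.distrib intro!: sum_mono)
  ultimately have "2 * q \<le> (wsq d a + h \<bullet> h) / l + l * r"
    unfolding q1 r_def by (simp add: add_divide_distrib algebra_simps)
  also have "\<dots> \<le> q + l * r" using q3 l by (simp add: field_simps)
  finally show ?thesis by (simp add: q_def l_def r_def b_def)
qed

text \<open>The vector \<open>z'\<close> is the full update of \<open>z\<close> with the components
  outside \<open>J\<close> erased, which is the form that the reduced dynamics take once the reduced
  state is padded.\<close>

lemma truncation_step:
  fixes A B C :: "real mat"
  assumes A: "A \<in> carrier_mat n' n" and B: "B \<in> carrier_mat n' m" and C: "C \<in> carrier_mat l n"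
    and d: "d \<in> carrier_vec n" "\<And>i. i < n \<Longrightarrow> 0 < d $ i"
    and d': "d' \<in> carrier_vec n'" "\<And>i. i < n' \<Longrightarrow> 0 < d' $ i \<and> d' $ i \<le> c"
    and \<beta>: "0 < \<beta>" "\<beta> < c"
    and reach: "\<And>p. p \<in> carrier_vec n' \<Longrightarrow>
      wsq d (transpose_mat A *\<^sub>v p) + (transpose_mat B *\<^sub>v p) \<bullet> (transpose_mat B *\<^sub>v p) + \<beta> * (p \<bullet> p)
        \<le> wsq d' p"
    and obs: "\<And>v. v \<in> carrier_vec n \<Longrightarrow> wsq d' (A *\<^sub>v v) + (C *\<^sub>v v) \<bullet> (C *\<^sub>v v) \<le> wsq d v"
    and x: "x \<in> carrier_vec n" and z: "z \<in> carrier_vec n" and u: "u \<in> carrier_vec m"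
    and x': "x' = A *\<^sub>v x + B *\<^sub>v u"
    and z': "\<And>i. i < n' \<Longrightarrow> z' $ i = (if i \<in> J then (A *\<^sub>v z + B *\<^sub>v u) $ i else 0)"
    and J: "\<And>i. i < n' \<Longrightarrow> i \<notin> J \<Longrightarrow> d' $ i = 1"
  shows "storage d' x' z' + (C *\<^sub>v (x - z)) \<bullet> (C *\<^sub>v (x - z))
    \<le> storage d x z + 4 * (1 - \<beta> / c) * (u \<bullet> u)"
proof -
  \<comment> \<open>\<open>f\<close> and \<open>g\<close> are the updates of \<open>x - z\<close>
    and \<open>x + z\<close> before any component is erased. The common input cancels in
    \<open>f\<close> and doubles in \<open>g\<close>, hence the constant 4.\<close>
  define f where "f = A *\<^sub>v (x - z)"
  define g where "g = A *\<^sub>v (x + z) + B *\<^sub>v (2 \<cdot>\<^sub>v u)"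
  have "storage d' x' z' \<le> wsq d' f + (\<Sum>i<n'. (g $ i)\<^sup>2 / d' $ i)"
  proof -
    have "d' $ i * (x' $ i - z' $ i)\<^sup>2 + (x' $ i + z' $ i)\<^sup>2 / d' $ i
        \<le> d' $ i * (f $ i)\<^sup>2 + (g $ i)\<^sup>2 / d' $ i" if i: "i < n'" for i
    proof -
      define a where "a = (A *\<^sub>v x) $ i"
      define k where "k = (A *\<^sub>v z) $ i"
      define h where "h = (B *\<^sub>v u) $ i"
      have e: "x' $ i = a + h" "(A *\<^sub>v z + B *\<^sub>v u) $ i = k + h" "f $ i = a - k"
        "g $ i = a + k + 2 * h"
        using A B i x z u unfolding x' f_def g_def a_def k_def h_def
        by (auto simp: mult_minus_distrib_mat_vec[OF A x z] mult_add_distrib_mat_vec[OF A x z]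
            mult_mat_vec[OF B u])
      show ?thesis
      proof (cases "i \<in> J")
        case True
        then show ?thesis using z'[OF i] by (simp add: e algebra_simps)
      next
        case False
        \<comment> \<open>On a truncated component the deficit is twice the square of the discarded update.\<close>
        have "(a - k)\<^sup>2 + (a + k + 2 * h)\<^sup>2 = (a + h)\<^sup>2 + (a + h)\<^sup>2 + 2 * (k + h)\<^sup>2"
          by (simp add: power2_eq_square algebra_simps)
        then show ?thesis using z'[OF i] J[OF i] False by (simp add: e)
      qed
    qed
    then show ?thesis
      using d' unfolding storage_def wsq_def by (auto simp flip: sum.distrib intro!: sum_mono)
  qed
  moreover have "wsq d' f + (C *\<^sub>v (x - z)) \<bullet> (C *\<^sub>v (x - z)) \<le> wsq d (x - z)"
    unfolding f_def using x z by (intro obs) auto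
  moreover have "(\<Sum>i<n'. (g $ i)\<^sup>2 / d' $ i)
      \<le> (1 - \<beta> / c) * ((\<Sum>i<n. ((x + z) $ i)\<^sup>2 / d $ i) + (2 \<cdot>\<^sub>v u) \<bullet> (2 \<cdot>\<^sub>v u))"
    unfolding g_def using x z u
    by (intro reachability_bound[OF A B d d' \<beta> reach]) auto
  moreover have "(2 \<cdot>\<^sub>v u) \<bullet> (2 \<cdot>\<^sub>v u) = 4 * (u \<bullet> u)"
    using u by simp
  \<comment> \<open>The terms in \<open>x + z\<close> are nonnegative, so their factor may be raised
    to 1 and the storage of the old state reappears. The factor on the input is kept and makes the
    final bound strict.\<close>
  moreover have "(1 - \<beta> / c) * (\<Sum>i<n. ((x + z) $ i)\<^sup>2 / d $ i) \<le> (\<Sum>i<n. ((x + z) $ i)\<^sup>2 / d $ i)"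
    using \<beta> d by (intro mult_left_le_one_le sum_nonneg divide_nonneg_nonneg) (auto intro: less_imp_le)
  moreover have "storage d x z = wsq d (x - z) + (\<Sum>i<n. ((x + z) $ i)\<^sup>2 / d $ i)"
    using d x z unfolding storage_def wsq_def by (auto simp flip: sum.distrib)
  ultimately show ?thesis by (simp add: algebra_simps)
qed

section \<open>From matrix inequalities to inequalities between quadratic forms\<close>

definition dmat :: "real vec \<Rightarrow> real mat" where
  "dmat d = mat_diag (dim_vec d) (($) d)"

definition dvec :: "real mat \<Rightarrow> real vec" where
  "dvec D = vec (dim_row D) (\<lambda>i. D $$ (i, i))"

lemma dmat_carrier: "d \<in> carrier_vec n \<Longrightarrow> dmat d \<in> carrier_mat n n"
  by (auto simp: dmat_def)

lemma dmat_dvec: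
  assumes "D \<in> carrier_mat n n" "diagonal_mat D"
  shows "dmat (dvec D) = D"
  using assms by (intro eq_matI) (auto simp: dmat_def dvec_def mat_diag_def diagonal_mat_def)

text \<open>Turns the block-diagonal gramian at a vertex into one weight vector, laid out in the
  same order as the stacked state.\<close>

lemma diag_block_mat_dmat: "diag_block_mat (map dmat ds) = dmat (vconcat ds)"
proof (induction ds)
  case Nil
  show ?case by (intro eq_matI) (auto simp: dmat_def mat_diag_def vconcat_def)
next
  case (Cons d ds)
  show ?case
    unfolding list.map diag_block_mat.simps Let_def Cons.IH vconcat_Cons
    by (intro eq_matI) (auto simp: dmat_def mat_diag_def)
qed

lemma quad_dmat:
  assumes "d \<in> carrier_vec n" "v \<in> carrier_vec n"
  shows "v \<bullet> (dmat d *\<^sub>v v) = wsq d v"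
proof -
  have "(dmat d *\<^sub>v v) $ i = d $ i * v $ i" if "i < n" for i
  proof -
    have "(dmat d *\<^sub>v v) $ i = (\<Sum>j\<in>{0..<n}. (if i = j then d $ j * v $ j else 0))"
      using that assms
      by (auto simp: dmat_def mat_diag_def scalar_prod_def if_distrib[of "\<lambda>c. c * _"] cong: if_cong intro!: sum.cong)
    then show ?thesis using that by (simp add: sum.delta)
  qed
  then show ?thesis
    using assms dmat_carrier[OF assms(1)]
    by (auto simp: wsq_def scalar_prod_def power2_eq_square lessThan_atLeast0 intro!: sum.cong)
qed

text \<open>The weak inequality also covers \<open>v = 0\<close>. No margin is lost by this, since
  in the gramian inequalities the margin is the explicit term with \<open>\<beta>\<close>.\<close>

lemma loewner_less_quad:
  assumes "X \<prec>\<^sub>L Y" "X \<in> carrier_mat n n" "Y \<in> carrier_mat n n" "v \<in> carrier_vec n"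
  shows "v \<bullet> (X *\<^sub>v v) \<le> v \<bullet> (Y *\<^sub>v v)"
proof (cases "v = 0\<^sub>v n")
  case True
  then show ?thesis using assms by simp
next
  case False
  then have "v \<bullet> ((Y - X) *\<^sub>v v) > 0"
    using assms by (auto simp: loewner_less_def pos_def_def)
  also have "v \<bullet> ((Y - X) *\<^sub>v v) = v \<bullet> (Y *\<^sub>v v) - v \<bullet> (X *\<^sub>v v)"
    using assms by (simp add: minus_mult_distrib_mat_vec[of _ n n] scalar_prod_minus_distrib[of _ n])
  finally show ?thesis by simp
qed

lemma quad_smult_one:
  "v \<in> carrier_vec n \<Longrightarrow> v \<bullet> ((c \<cdot>\<^sub>m 1\<^sub>m n) *\<^sub>v v) = (c :: real) * (v \<bullet> v)"
proof -
  assume v: "v \<in> carrier_vec n"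
  have "c \<cdot>\<^sub>m 1\<^sub>m n = dmat (vec n (\<lambda>_. c))"
    by (intro eq_matI) (auto simp: dmat_def mat_diag_def)
  then have "v \<bullet> ((c \<cdot>\<^sub>m 1\<^sub>m n) *\<^sub>v v) = wsq (vec n (\<lambda>_. c)) v"
    using quad_dmat[OF vec_carrier v] by simp
  then show ?thesis using v by (simp add: wsq_def scalar_prod_self sum_distrib_left)
qed

text \<open>Evaluate the matrix inequality at \<open>p\<close> and move \<open>A\<close> and
  \<open>B\<close> to the other side of the inner product. The statement serves both gramian
  inequalities: observability is the instance with the transposes of \<open>A\<close> and
  \<open>C\<close> in place of \<open>A\<close> and \<open>B\<close>.\<close>

lemma gramian_quad:
  fixes A B :: "real mat"
  assumes A: "A \<in> carrier_mat n' n" and B: "B \<in> carrier_mat n' m"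
    and d: "d \<in> carrier_vec n" and d': "d' \<in> carrier_vec n'"
    and lmi: "A * dmat d * transpose_mat A - dmat d' + B * transpose_mat B \<prec>\<^sub>L (- \<beta>) \<cdot>\<^sub>m 1\<^sub>m n'"
    and p: "p \<in> carrier_vec n'"
  shows "wsq d (transpose_mat A *\<^sub>v p) + (transpose_mat B *\<^sub>v p) \<bullet> (transpose_mat B *\<^sub>v p) + \<beta> * (p \<bullet> p)
        \<le> wsq d' p"
proof -
  note D = dmat_carrier[OF d] and D' = dmat_carrier[OF d']
  define a where "a = transpose_mat A *\<^sub>v p"
  define b where "b = transpose_mat B *\<^sub>v p"
  have a: "a \<in> carrier_vec n" and b: "b \<in> carrier_vec m"
    using A B p by (auto simp: a_def b_def)
  have X: "A * dmat d * transpose_mat A \<in> carrier_mat n' n'" "B * transpose_mat B \<in> carrier_mat n' n'"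
    using A B D by auto
  have "p \<bullet> ((A * dmat d * transpose_mat A - dmat d' + B * transpose_mat B) *\<^sub>v p)
      = p \<bullet> (A *\<^sub>v (dmat d *\<^sub>v a)) - p \<bullet> (dmat d' *\<^sub>v p) + p \<bullet> (B *\<^sub>v b)"
  proof -
    have "(A * dmat d * transpose_mat A) *\<^sub>v p = A *\<^sub>v (dmat d *\<^sub>v a)"
      using assoc_mult_mat_vec[of "A * dmat d" n' n "transpose_mat A" n' p]
        assoc_mult_mat_vec[of A n' n "dmat d" n a] A D p a by (simp add: a_def)
    moreover have "(B * transpose_mat B) *\<^sub>v p = B *\<^sub>v b"
      using assoc_mult_mat_vec[of B n' m "transpose_mat B" n' p] B p by (simp add: b_def)
    ultimately have "(A * dmat d * transpose_mat A - dmat d' + B * transpose_mat B) *\<^sub>v p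
      = A *\<^sub>v (dmat d *\<^sub>v a) - dmat d' *\<^sub>v p + B *\<^sub>v b"
      unfolding add_mult_distrib_mat_vec[OF minus_carrier_mat[OF D'] X(2) p]
        minus_mult_distrib_mat_vec[OF X(1) D' p] by (simp only:)
    then show ?thesis
      using A B D D' a b p
      by (simp add: scalar_prod_add_distrib[of _ n'] scalar_prod_minus_distrib[of _ n'])
  qed
  also have "\<dots> = wsq d a - wsq d' p + b \<bullet> b"
  proof -
    have "p \<bullet> (A *\<^sub>v (dmat d *\<^sub>v a)) = a \<bullet> (dmat d *\<^sub>v a)"
      unfolding a_def using A D p by (subst transpose_vec_mult_scalar[of _ n' n]) (auto simp: a_def)
    moreover have "p \<bullet> (B *\<^sub>v b) = b \<bullet> b"
      unfolding b_def using B p by (subst transpose_vec_mult_scalar[of _ n' m]) auto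
    ultimately show ?thesis using quad_dmat[OF d a] quad_dmat[OF d' p] by simp
  qed
  finally have "p \<bullet> ((A * dmat d * transpose_mat A - dmat d' + B * transpose_mat B) *\<^sub>v p)
    = wsq d a - wsq d' p + b \<bullet> b" .
  moreover have "p \<bullet> ((A * dmat d * transpose_mat A - dmat d' + B * transpose_mat B) *\<^sub>v p)
      \<le> p \<bullet> (((- \<beta>) \<cdot>\<^sub>m 1\<^sub>m n') *\<^sub>v p)"
    using X D' p by (intro loewner_less_quad[OF lmi, of n']) auto
  ultimately show ?thesis by (simp only: quad_smult_one[OF p] a_def b_def)
qed

section \<open>Deleting rows and columns, and the matching operation on vectors\<close>

text \<open>The vector counterpart of \<open>submatrix\<close>, with the same enumeration
  \<open>pick\<close> and the same dimension count, so that the two can be multiplied.\<close>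

definition restrict_vec :: "nat set \<Rightarrow> real vec \<Rightarrow> real vec" where
  "restrict_vec I v = vec (card {i. i < dim_vec v \<and> i \<in> I}) (\<lambda>i. v $ pick I i)"

lemma restrict_vec_UNIV: "restrict_vec UNIV v = v"
  by (intro eq_vecI) (auto simp: restrict_vec_def pick_UNIV)

text \<open>\<open>card {a \<in> I. a < l}\<close> is the rank of \<open>l\<close> in
  \<open>I\<close>: the position that \<open>l\<close> takes once the indices outside
  \<open>I\<close> are deleted. It is the inverse of \<open>pick I\<close>.\<close>

lemma rank_less:
  fixes l n :: nat
  assumes "l < n" "l \<in> I"
  shows "card {a \<in> I. a < l} < card {i. i < n \<and> i \<in> I}"
proof (rule psubset_card_mono)
  have "l \<in> {i. i < n \<and> i \<in> I}" "l \<notin> {a \<in> I. a < l}" using assms by simp_all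
  moreover have "{a \<in> I. a < l} \<subseteq> {i. i < n \<and> i \<in> I}" using assms by auto
  ultimately show "{a \<in> I. a < l} \<subset> {i. i < n \<and> i \<in> I}" by blast
qed simp

lemma rank_pick:
  assumes "i < card {i. i < n \<and> i \<in> I}"
  shows "card {a \<in> I. a < pick I i} = i" "pick I i \<in> I" "pick I i < n"
proof -
  \<comment> \<open>The infinite case is a real one: \<open>UNIV\<close> occurs as an index set, and
    its \<open>card\<close> is 0.\<close>
  have "i < card I \<or> infinite I"
  proof (cases "finite I")
    case True
    then have "card {i. i < n \<and> i \<in> I} \<le> card I" by (intro card_mono) auto
    with assms show ?thesis by linarith
  qed simp
  then show "card {a \<in> I. a < pick I i} = i" "pick I i \<in> I"
    by (rule card_pick, rule pick_in_set)
  show "pick I i < n" using assms by (rule pick_le)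
qed

text \<open>The deleted columns only meet zero entries of \<open>v\<close>. Hence the reduced
  dynamics can be written with the full matrices acting on the padded state.\<close>

lemma submatrix_mult_restrict_vec:
  fixes A :: "real mat"
  assumes A: "A \<in> carrier_mat n m" and v: "v \<in> carrier_vec m"
    and zero: "\<And>l. l < m \<Longrightarrow> l \<notin> I \<Longrightarrow> v $ l = 0"
  shows "submatrix A J I *\<^sub>v restrict_vec I v = restrict_vec J (A *\<^sub>v v)"
proof (rule eq_vecI)
  fix i assume "i < dim_vec (restrict_vec J (A *\<^sub>v v))"
  then have i: "i < card {i. i < n \<and> i \<in> J}" using A by (simp add: restrict_vec_def)
  note ri = rank_pick[OF i]
  let ?c = "card {i. i < m \<and> i \<in> I}"
  have "(submatrix A J I *\<^sub>v restrict_vec I v) $ i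
      = (\<Sum>j<?c. A $$ (pick J i, pick I j) * v $ pick I j)"
    using A v i by (auto simp: submatrix_def restrict_vec_def scalar_prod_def lessThan_atLeast0)
  also have "\<dots> = (\<Sum>l | l < m \<and> l \<in> I. A $$ (pick J i, l) * v $ l)"
  proof (rule sum.reindex_bij_witness[of _ "\<lambda>l. card {a \<in> I. a < l}" "pick I"])
    fix j assume "j \<in> {..<?c}"
    then have j: "j < ?c" by simp
    show "card {a \<in> I. a < pick I j} = j" "pick I j \<in> {l. l < m \<and> l \<in> I}"
      using rank_pick[OF j] by simp_all
  next
    fix l assume "l \<in> {l. l < m \<and> l \<in> I}"
    then show "pick I (card {a \<in> I. a < l}) = l" "card {a \<in> I. a < l} \<in> {..<?c}"
      using pick_card_in_set[of l I] rank_less[of l m I] by simp_all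
  qed (rule refl)
  also have "\<dots> = (\<Sum>l<m. A $$ (pick J i, l) * v $ l)"
    using zero by (intro sum.mono_neutral_left) auto
  also have "\<dots> = restrict_vec J (A *\<^sub>v v) $ i"
    using A v i ri by (auto simp: restrict_vec_def scalar_prod_def lessThan_atLeast0)
  finally show "(submatrix A J I *\<^sub>v restrict_vec I v) $ i = restrict_vec J (A *\<^sub>v v) $ i" .
qed (use A in \<open>simp add: restrict_vec_def dim_submatrix\<close>)

lemma restrict_vec_add:
  assumes "v \<in> carrier_vec n" "w \<in> carrier_vec n"
  shows "restrict_vec I (v + w) = restrict_vec I v + restrict_vec I w"
proof (rule eq_vecI)
  fix i assume "i < dim_vec (restrict_vec I v + restrict_vec I w)"
  then have i: "i < card {i. i < n \<and> i \<in> I}" using assms by (simp add: restrict_vec_def)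
  then show "restrict_vec I (v + w) $ i = (restrict_vec I v + restrict_vec I w) $ i"
    using assms rank_pick(3)[OF i] by (simp add: restrict_vec_def)
qed (use assms in \<open>simp add: restrict_vec_def\<close>)

lemma restrict_vec_rank:
  assumes "v \<in> carrier_vec n" "l < n" "l \<in> I"
  shows "restrict_vec I v $ card {a \<in> I. a < l} = v $ l"
  using assms rank_less[of l n I] by (simp add: restrict_vec_def pick_card_in_set)

section \<open>Concatenated blocks, padding and the kept indices\<close>

lemma vconcat_map_carrier:
  assumes "\<And>j. j \<in> set js \<Longrightarrow> f j \<in> carrier_vec (n j)"
  shows "vconcat (map f js) \<in> carrier_vec (sum_list (map n js))"
  using assms by (intro vconcat_carrier) (simp add: list_all2_conv_all_nth)

lemma storage_append:
  assumes "d \<in> carrier_vec n" "x \<in> carrier_vec n" "z \<in> carrier_vec n"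
    and "d' \<in> carrier_vec m" "x' \<in> carrier_vec m" "z' \<in> carrier_vec m"
  shows "storage (d @\<^sub>v d') (x @\<^sub>v x') (z @\<^sub>v z') = storage d x z + storage d' x' z'"
proof -
  define f where "f i = (d @\<^sub>v d') $ i * ((x @\<^sub>v x') $ i - (z @\<^sub>v z') $ i)\<^sup>2
    + ((x @\<^sub>v x') $ i + (z @\<^sub>v z') $ i)\<^sup>2 / (d @\<^sub>v d') $ i" for i
  have "storage (d @\<^sub>v d') (x @\<^sub>v x') (z @\<^sub>v z') = (\<Sum>i<n + m. f i)"
    using assms by (simp add: storage_def f_def)
  also have "\<dots> = (\<Sum>i<n. f i) + (\<Sum>i<m. f (n + i))"
    by (induction m) simp_all
  also have "\<dots> = storage d x z + storage d' x' z'"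
    using assms by (simp add: storage_def f_def)
  finally show ?thesis .
qed

lemma storage_vconcat:
  assumes "\<And>j. j \<in> set js \<Longrightarrow>
    d j \<in> carrier_vec (n j) \<and> x j \<in> carrier_vec (n j) \<and> z j \<in> carrier_vec (n j)"
  shows "storage (vconcat (map d js)) (vconcat (map x js)) (vconcat (map z js))
    = (\<Sum>j\<leftarrow>js. storage (d j) (x j) (z j))"
  using assms
proof (induction js)
  case Nil
  show ?case by (simp add: storage_def vconcat_def)
next
  case (Cons j js)
  have "storage (d j @\<^sub>v vconcat (map d js)) (x j @\<^sub>v vconcat (map x js)) (z j @\<^sub>v vconcat (map z js))
    = storage (d j) (x j) (z j) + storage (vconcat (map d js)) (vconcat (map x js)) (vconcat (map z js))"
    using Cons.prems
    by (intro storage_append[of _ "n j" _ _ _ "sum_list (map n js)"] vconcat_map_carrier) auto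
  then show ?case using Cons by (simp add: vconcat_Cons)
qed

abbreviation kept_of :: "('j \<Rightarrow> nat) \<Rightarrow> ('j \<Rightarrow> nat) \<Rightarrow> 'j list \<Rightarrow> nat set" where
  "kept_of n r js \<equiv> kept (zip (map n js) (map r js))"

text \<open>\<open>P\<close> sees both whether the index is kept and the entry there. One induction
  over the blocks thus yields the bounds on the weights, the value 1 of truncated weights and the
  zeros of padded states.\<close>

lemma vconcat_index_property:
  assumes "\<And>j. j \<in> set js \<Longrightarrow> f j \<in> carrier_vec (n j) \<and> r j \<le> n j"
    and "\<And>j i. j \<in> set js \<Longrightarrow> i < n j \<Longrightarrow> P (i < r j) (f j $ i)"
    and "l < sum_list (map n js)"
  shows "P (l \<in> kept_of n r js) (vconcat (map f js) $ l)"
  using assms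
proof (induction js arbitrary: l)
  case Nil
  then show ?case by simp
next
  case (Cons j js)
  have f: "f j \<in> carrier_vec (n j)" "r j \<le> n j" using Cons.prems(1) by auto
  have g: "vconcat (map f js) \<in> carrier_vec (sum_list (map n js))"
    using Cons.prems(1) by (intro vconcat_map_carrier) simp
  show ?case
  proof (cases "l < n j")
    case True
    then have "l \<in> kept_of n r (j # js) \<longleftrightarrow> l < r j" by auto
    moreover have "vconcat (map f (j # js)) $ l = f j $ l"
      using True f g by (simp add: vconcat_Cons)
    ultimately show ?thesis using Cons.prems(2)[of j l] True by simp
  next
    case False
    then obtain i where l: "l = n j + i" using le_Suc_ex not_less by blast
    then have "l \<in> kept_of n r (j # js) \<longleftrightarrow> i \<in> kept_of n r js" using f by auto
    moreover have "vconcat (map f (j # js)) $ l = vconcat (map f js) $ i"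
      using f g l Cons.prems(3) by (simp add: vconcat_Cons)
    moreover have "P (i \<in> kept_of n r js) (vconcat (map f js) $ i)"
      using Cons.prems l by (intro Cons.IH) auto
    ultimately show ?thesis by simp
  qed
qed

text \<open>The zeros go to the end of each block because truncation keeps the first components of a
  block.\<close>

definition pad :: "nat \<Rightarrow> real vec \<Rightarrow> real vec" where
  "pad n v = v @\<^sub>v 0\<^sub>v (n - dim_vec v)"

lemma pad_carrier: "v \<in> carrier_vec r \<Longrightarrow> r \<le> n \<Longrightarrow> pad n v \<in> carrier_vec n"
  unfolding pad_def by (metis append_carrier_vec carrier_vecD le_add_diff_inverse zero_carrier_vec)

lemma pad_index: "v \<in> carrier_vec r \<Longrightarrow> i < n \<Longrightarrow> pad n v $ i = (if i < r then v $ i else 0)"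
  by (auto simp: pad_def)

lemma rank_kept_first:
  assumes "r \<le> n" "l < r"
  shows "card {a \<in> {..<r} \<union> (+) n ` K. a < l} = l"
proof -
  have "{a \<in> {..<r} \<union> (+) n ` K. a < l} = {..<l}" using assms by auto
  then show ?thesis by simp
qed

text \<open>A first block of length \<open>n\<close> contributes only its \<open>r\<close> kept
  indices to the rank of anything behind it.\<close>

lemma rank_kept_rest:
  assumes "r \<le> n"
  shows "card {a \<in> {..<r} \<union> (+) n ` K. a < n + i} = r + card {a \<in> K. a < i}"
proof -
  have "{a \<in> {..<r} \<union> (+) n ` K. a < n + i} = {..<r} \<union> (+) n ` {a \<in> K. a < i}"
    using assms by auto
  moreover have "card ({..<r} \<union> (+) n ` {a \<in> K. a < i}) = r + card {a \<in> K. a < i}"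
    using assms by (subst card_Un_disjoint) (auto simp: card_image)
  ultimately show ?thesis by simp
qed

text \<open>Padding shifts the entries of later blocks to the right, and taking ranks among the kept
  indices undoes that shift.\<close>

lemma vconcat_rank_kept:
  assumes "\<And>j. j \<in> set js \<Longrightarrow> z j \<in> carrier_vec (r j) \<and> r j \<le> n j"
    and "l < sum_list (map n js)" "l \<in> kept_of n r js"
  shows "vconcat (map z js) $ card {a \<in> kept_of n r js. a < l} = vconcat (map (\<lambda>j. pad (n j) (z j)) js) $ l"
  using assms
proof (induction js arbitrary: l)
  case Nil
  then show ?case by simp
next
  case (Cons j js)
  let ?p = "\<lambda>j. pad (n j) (z j)"
  have z: "z j \<in> carrier_vec (r j)" "r j \<le> n j" using Cons.prems(1) by auto
  have p: "?p j \<in> carrier_vec (n j)" using z by (rule pad_carrier)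
  have zs: "vconcat (map z js) \<in> carrier_vec (sum_list (map r js))"
    using Cons.prems(1) by (intro vconcat_map_carrier) simp
  have ps: "vconcat (map ?p js) \<in> carrier_vec (sum_list (map n js))"
    using Cons.prems(1) by (intro vconcat_map_carrier pad_carrier) auto
  have K: "kept_of n r (j # js) = {..<r j} \<union> (+) (n j) ` kept_of n r js" by simp
  show ?case
  proof (cases "l < n j")
    case True
    then have l: "l < r j" using Cons.prems(3) by auto
    show ?thesis
      unfolding K rank_kept_first[OF z(2) l]
      using True l z p zs ps by (simp add: vconcat_Cons pad_index[OF z(1)])
  next
    case False
    then obtain i where l: "l = n j + i" using le_Suc_ex not_less by blast
    have i: "i \<in> kept_of n r js" "i < sum_list (map n js)" using Cons.prems(2,3) z l by auto
    have le: "list_all2 (\<le>) (map r js) (map n js)"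
      using Cons.prems(1) by (simp add: list_all2_conv_all_nth)
    have "card {a \<in> kept_of n r js. a < i} < sum_list (map r js)"
      using rank_less[OF i(2,1)] card_kept_less[OF le] by simp
    then have "vconcat (map z (j # js)) $ (r j + card {a \<in> kept_of n r js. a < i})
        = vconcat (map z js) $ card {a \<in> kept_of n r js. a < i}"
      using z zs by (simp add: vconcat_Cons)
    also have "\<dots> = vconcat (map ?p js) $ i"
      using Cons.prems i by (intro Cons.IH) auto
    also have "\<dots> = vconcat (map ?p (j # js)) $ l"
      using p ps i l by (simp add: vconcat_Cons)
    finally show ?thesis unfolding K l rank_kept_rest[OF z(2)] .
  qed
qed

text \<open>This is \<open>vconcat_rank_kept\<close> read at \<open>pick\<close>, the inverse of the
  rank. The reduced state is recovered from the padded one, so both systems can be compared in the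
  full dimension.\<close>

lemma restrict_vec_pad:
  assumes "\<And>j. j \<in> set js \<Longrightarrow> z j \<in> carrier_vec (r j) \<and> r j \<le> n j"
  shows "restrict_vec (kept_of n r js) (vconcat (map (\<lambda>j. pad (n j) (z j)) js)) = vconcat (map z js)"
    (is "restrict_vec ?K ?p = ?z")
proof (rule eq_vecI)
  have le: "list_all2 (\<le>) (map r js) (map n js)"
    using assms by (simp add: list_all2_conv_all_nth)
  have z: "?z \<in> carrier_vec (sum_list (map r js))"
    using assms by (intro vconcat_map_carrier) simp
  have p: "?p \<in> carrier_vec (sum_list (map n js))"
    using assms by (intro vconcat_map_carrier pad_carrier) auto
  show "dim_vec (restrict_vec ?K ?p) = dim_vec ?z"
    using z p card_kept_less[OF le] by (simp add: restrict_vec_def)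
  fix i assume "i < dim_vec ?z"
  then have i: "i < card {i. i < sum_list (map n js) \<and> i \<in> ?K}"
    using z card_kept_less[OF le] by simp
  have "?z $ card {a \<in> ?K. a < pick ?K i} = ?p $ pick ?K i"
    using assms rank_pick[OF i] by (intro vconcat_rank_kept) auto
  then show "restrict_vec ?K ?p $ i = ?z $ i"
    using i p by (simp add: restrict_vec_def rank_pick(1)[OF i])
qed

lemma vconcat_pad_index_not_kept:
  assumes "\<And>j. j \<in> set js \<Longrightarrow> z j \<in> carrier_vec (r j) \<and> r j \<le> n j"
    and "l < sum_list (map n js)" "l \<notin> kept_of n r js"
  shows "vconcat (map (\<lambda>j. pad (n j) (z j)) js) $ l = 0"
proof -
  have "l \<notin> kept_of n r js \<longrightarrow> vconcat (map (\<lambda>j. pad (n j) (z j)) js) $ l = 0"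
    using assms(1,2)
    by (intro vconcat_index_property[where P = "\<lambda>b x. \<not> b \<longrightarrow> x = 0"])
      (auto simp: pad_index[OF conjunct1[OF assms(1)]] intro!: pad_carrier)
  with assms(3) show ?thesis by simp
qed

section \<open>Vertices and edges as carriers of the state\<close>

text \<open>A site is a vertex or an edge: the places that carry a block of the state.  Every site occurs
  in exactly one \<open>in_sites G k\<close> and in exactly one \<open>out_sites G k\<close>, so that the local dissipation
  inequalities at the vertices add up to one for the network.\<close>

definition block ::
  "(nat \<Rightarrow> nat \<Rightarrow> 'b) \<Rightarrow> (nat \<times> nat \<Rightarrow> nat \<Rightarrow> 'b) \<Rightarrow> nat \<Rightarrow> nat + nat \<times> nat \<Rightarrow> 'b" where
  "block X Z t = case_sum (\<lambda>k. X k t) (\<lambda>e. Z e t)"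

definition in_sites :: "dsys \<Rightarrow> nat \<Rightarrow> (nat + nat \<times> nat) list" where
  "in_sites G k = Inl k # map (\<lambda>i. Inr (i, k)) (in_list G k)"

definition out_sites :: "dsys \<Rightarrow> nat \<Rightarrow> (nat + nat \<times> nat) list" where
  "out_sites G k = Inl k # map (\<lambda>j. Inr (k, j)) (out_list G k)"

definition sites :: "dsys \<Rightarrow> (nat + nat \<times> nat) set" where
  "sites G = Inl ` verts G \<union> Inr ` edges G"

lemma in_blocks_sites: "in_blocks G X Z k t = map (block X Z t) (in_sites G k)"
  by (simp add: in_blocks_def in_sites_def block_def)

lemma out_blocks_sites: "out_blocks G X Z k t = map (block X Z t) (out_sites G k)"
  by (simp add: out_blocks_def out_sites_def block_def)

lemma in_sites_subset: "k \<in> verts G \<Longrightarrow> j \<in> set (in_sites G k) \<Longrightarrow> j \<in> sites G"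
  by (auto simp: in_sites_def sites_def set_in_list)

lemma out_sites_subset: "k \<in> verts G \<Longrightarrow> j \<in> set (out_sites G k) \<Longrightarrow> j \<in> sites G"
  by (auto simp: out_sites_def sites_def set_out_list)

lemma finite_verts: "finite (verts G)"
  by (simp add: verts_def)

lemma finite_edges: "edges G \<subseteq> verts G \<times> verts G \<Longrightarrow> finite (edges G)"
  using finite_subset finite_verts by blast

lemma distinct_in_list: "distinct (in_list G k)"
  by (simp add: in_list_def)

lemma sum_sites:
  fixes f :: "nat + nat \<times> nat \<Rightarrow> real"
  assumes "edges G \<subseteq> verts G \<times> verts G"
  shows "(\<Sum>j\<in>sites G. f j) = (\<Sum>k\<in>verts G. f (Inl k)) + (\<Sum>e\<in>edges G. f (Inr e))"
  unfolding sites_def using finite_verts finite_edges[OF assms]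
  by (subst sum.union_disjoint) (auto simp: sum.reindex)

lemma sum_in_sites:
  fixes f :: "nat + nat \<times> nat \<Rightarrow> real"
  assumes E: "edges G \<subseteq> verts G \<times> verts G"
  shows "(\<Sum>k\<in>verts G. \<Sum>j\<leftarrow>in_sites G k. f j) = (\<Sum>j\<in>sites G. f j)"
proof -
  have "(\<Sum>k\<in>verts G. \<Sum>i\<in>{i \<in> verts G. (i, k) \<in> edges G}. f (Inr (i, k)))
    = (\<Sum>(k, i)\<in>(SIGMA k:verts G. {i \<in> verts G. (i, k) \<in> edges G}). f (Inr (i, k)))"
    by (rule sum.Sigma) (auto simp: finite_verts)
  \<comment> \<open>Here the pairs list the head of an edge first, whereas an edge lists its tail
    first; hence the swap.\<close>
  also have "\<dots> = (\<Sum>e\<in>edges G. f (Inr e))"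
    using E by (intro sum.reindex_bij_witness[of _ prod.swap prod.swap]) auto
  finally show ?thesis
    unfolding sum_sites[OF E] in_sites_def
    by (simp add: sum.distrib comp_def sum_list_distinct_conv_sum_set[OF distinct_in_list] set_in_list)
qed

lemma sum_out_sites:
  fixes f :: "nat + nat \<times> nat \<Rightarrow> real"
  assumes E: "edges G \<subseteq> verts G \<times> verts G"
  shows "(\<Sum>k\<in>verts G. \<Sum>j\<leftarrow>out_sites G k. f j) = (\<Sum>j\<in>sites G. f j)"
proof -
  have "(\<Sum>k\<in>verts G. \<Sum>j\<in>{j \<in> verts G. (k, j) \<in> edges G}. f (Inr (k, j)))
    = (\<Sum>(k, j)\<in>(SIGMA k:verts G. {j \<in> verts G. (k, j) \<in> edges G}). f (Inr (k, j)))"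
    by (rule sum.Sigma) (auto simp: finite_verts)
  also have "(SIGMA k:verts G. {j \<in> verts G. (k, j) \<in> edges G}) = edges G"
    using E by auto
  finally show ?thesis
    unfolding sum_sites[OF E] out_sites_def
    by (simp add: sum.distrib comp_def sum_list_distinct_conv_sum_set[OF distinct_out_list] set_out_list
        case_prod_beta)
qed

section \<open>Energy balance along a pair of trajectories with the same input\<close>

lemma trajectory_carrier:
  assumes "trajectory G u xT xS y" "j \<in> sites G"
  shows "block xT xS t j \<in> carrier_vec (block (tdim G) (sdim G) t j)"
  using assms by (auto simp: trajectory_def sites_def block_def)

lemma trajectory_zero:
  assumes "trajectory G u xT xS y" "j \<in> sites G"
  shows "block xT xS 0 j = 0\<^sub>v (block (tdim G) (sdim G) 0 j)"
  using assms by (auto simp: trajectory_def sites_def block_def)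

lemma trajectory_step:
  assumes "trajectory G u xT xS y" "k \<in> verts G"
  shows "vconcat (map (block xT xS (t + 1)) (out_sites G k)) =
      Amat G k t *\<^sub>v vconcat (map (block xT xS t) (in_sites G k)) + Bmat G k t *\<^sub>v u k t"
    and "y k t = Cmat G k t *\<^sub>v vconcat (map (block xT xS t) (in_sites G k)) + Dmat G k t *\<^sub>v u k t"
  using assms unfolding trajectory_def in_blocks_sites out_blocks_sites by blast+

text \<open>The setting of the theorem with every gramian replaced by its diagonal
  \<open>d t j\<close>; \<open>d_one\<close> is the condition that the truncated blocks are
  identities. The bound \<open>c\<close> is common to all sites and times, so that
  \<open>1 - \<beta> / c\<close> is a single constant.\<close>

locale unit_truncation =
  fixes G :: dsys and rT rS and d :: "nat \<Rightarrow> nat + nat \<times> nat \<Rightarrow> real vec" and \<beta> c :: real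
  assumes dims: "dims_ok G"
    and r_le: "j \<in> sites G \<Longrightarrow> block rT rS t j \<le> block (tdim G) (sdim G) t j"
    and d_carrier: "j \<in> sites G \<Longrightarrow> d t j \<in> carrier_vec (block (tdim G) (sdim G) t j)"
    and d_pos: "j \<in> sites G \<Longrightarrow> i < block (tdim G) (sdim G) t j \<Longrightarrow> 0 < d t j $ i \<and> d t j $ i \<le> c"
    and d_one: "j \<in> sites G \<Longrightarrow> block rT rS t j \<le> i \<Longrightarrow> i < block (tdim G) (sdim G) t j \<Longrightarrow> d t j $ i = 1"
    and \<beta>: "0 < \<beta>" "\<beta> < c"
    and reach: "k \<in> verts G \<Longrightarrow>
      Amat G k t * dmat (vconcat (map (d t) (in_sites G k))) * transpose_mat (Amat G k t)
        - dmat (vconcat (map (d (t + 1)) (out_sites G k))) + Bmat G k t * transpose_mat (Bmat G k t)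
      \<prec>\<^sub>L (- \<beta>) \<cdot>\<^sub>m 1\<^sub>m (out_dim G k (t + 1))"
    and obs: "k \<in> verts G \<Longrightarrow>
      transpose_mat (Amat G k t) * dmat (vconcat (map (d (t + 1)) (out_sites G k))) * Amat G k t
        - dmat (vconcat (map (d t) (in_sites G k))) + transpose_mat (Cmat G k t) * Cmat G k t
      \<prec>\<^sub>L (- \<beta>) \<cdot>\<^sub>m 1\<^sub>m (in_dim G k t)"
begin

abbreviation "n t j \<equiv> block (tdim G) (sdim G) t j"
abbreviation "r t j \<equiv> block rT rS t j"
abbreviation "H \<equiv> truncate_sys G rT rS"

lemma truncated_simps: "verts H = verts G" "sites H = sites G" "tdim H = rT" "sdim H = rS"
  "in_sites H k = in_sites G k" "out_sites H k = out_sites G k" "Dmat H = Dmat G"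
  "Amat H k t = submatrix (Amat G k t) (kept_of (n (t + 1)) (r (t + 1)) (out_sites G k))
    (kept_of (n t) (r t) (in_sites G k))"
  "Bmat H k t = submatrix (Bmat G k t) (kept_of (n (t + 1)) (r (t + 1)) (out_sites G k)) UNIV"
  "Cmat H k t = submatrix (Cmat G k t) UNIV (kept_of (n t) (r t) (in_sites G k))"
  by (simp_all add: truncate_sys_def verts_def sites_def in_sites_def out_sites_def in_list_def
      out_list_def in_blocks_def out_blocks_def block_def comp_def)

text \<open>An instance of \<open>truncation_step\<close>. It compares the outgoing sites at time
  \<open>t + 1\<close> with the incoming sites at time \<open>t\<close>, so a balance of one storage
  function appears only after summation over all vertices.\<close>

lemma vertex_dissipation:
  assumes k: "k \<in> verts G" and u: "u k t \<in> carrier_vec (udim G k t)"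
    and G: "trajectory G u xT xS y" and H: "trajectory H u zT zS w"
  defines "x \<equiv> block xT xS" and "z \<equiv> \<lambda>t j. pad (n t j) (block zT zS t j)"
  shows "(\<Sum>j\<leftarrow>out_sites G k. storage (d (t + 1) j) (x (t + 1) j) (z (t + 1) j))
      + (y k t - w k t) \<bullet> (y k t - w k t)
    \<le> (\<Sum>j\<leftarrow>in_sites G k. storage (d t j) (x t j) (z t j)) + 4 * (1 - \<beta> / c) * (u k t \<bullet> u k t)"
proof -
  let ?i = "in_sites G k" and ?o = "out_sites G k"
  let ?I = "kept_of (n t) (r t) ?i" and ?J = "kept_of (n (t + 1)) (r (t + 1)) ?o"
  note i = in_sites_subset[OF k] and o = out_sites_subset[OF k]
  have c: "Amat G k t \<in> carrier_mat (sum_list (map (n (t + 1)) ?o)) (sum_list (map (n t) ?i))"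
    "Bmat G k t \<in> carrier_mat (sum_list (map (n (t + 1)) ?o)) (udim G k t)"
    "Cmat G k t \<in> carrier_mat (ydim G k t) (sum_list (map (n t) ?i))"
    "Dmat G k t \<in> carrier_mat (ydim G k t) (udim G k t)"
    using dims k unfolding dims_ok_def in_blocks_sites out_blocks_sites by blast+
  note AT = transpose_carrier_mat[THEN iffD2, OF c(1)] and CT = transpose_carrier_mat[THEN iffD2, OF c(3)]
  have x: "x t j \<in> carrier_vec (n t j)" if "j \<in> sites G" for t j
    unfolding x_def using that by (rule trajectory_carrier[OF G])
  have zr: "block zT zS t j \<in> carrier_vec (r t j)" if "j \<in> sites G" for t j
    using trajectory_carrier[OF H, of j t] that by (simp add: truncated_simps)
  have z: "z t j \<in> carrier_vec (n t j)" if "j \<in> sites G" for t j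
    unfolding z_def using that by (intro pad_carrier[OF zr r_le])
  define X where "X = vconcat (map (x t) ?i)"
  define X' where "X' = vconcat (map (x (t + 1)) ?o)"
  define Z where "Z = vconcat (map (z t) ?i)"
  define Z' where "Z' = vconcat (map (z (t + 1)) ?o)"
  define W where "W = vconcat (map (d t) ?i)"
  define W' where "W' = vconcat (map (d (t + 1)) ?o)"
  have Xc: "X \<in> carrier_vec (sum_list (map (n t) ?i))" and Zc: "Z \<in> carrier_vec (sum_list (map (n t) ?i))"
    and Wc: "W \<in> carrier_vec (sum_list (map (n t) ?i))"
    unfolding X_def Z_def W_def using x z d_carrier i by (auto intro!: vconcat_map_carrier)
  have Z'c: "Z' \<in> carrier_vec (sum_list (map (n (t + 1)) ?o))"
    and W'c: "W' \<in> carrier_vec (sum_list (map (n (t + 1)) ?o))"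
    unfolding Z'_def W'_def using z d_carrier o by (auto intro!: vconcat_map_carrier)
  have Zr: "restrict_vec ?I Z = vconcat (map (block zT zS t) ?i)"
    unfolding Z_def z_def using zr r_le i by (intro restrict_vec_pad) auto
  have Z'r: "restrict_vec ?J Z' = vconcat (map (block zT zS (t + 1)) ?o)"
    unfolding Z'_def z_def using zr r_le o by (intro restrict_vec_pad) auto
  have Z0: "Z $ l = 0" if "l < sum_list (map (n t) ?i)" "l \<notin> ?I" for l
    unfolding Z_def z_def using zr r_le i that by (intro vconcat_pad_index_not_kept[of _ _ "r t"]) auto
  have Z'0: "Z' $ l = 0" if "l < sum_list (map (n (t + 1)) ?o)" "l \<notin> ?J" for l
    unfolding Z'_def z_def using zr r_le o that
    by (intro vconcat_pad_index_not_kept[of _ _ "r (t + 1)"]) auto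
  have X'eq: "X' = Amat G k t *\<^sub>v X + Bmat G k t *\<^sub>v u k t"
    unfolding X'_def X_def x_def by (rule trajectory_step[OF G k])
  \<comment> \<open>The reduced update, transcribed to padded states: since \<open>Z\<close>
    vanishes outside \<open>?I\<close>, the submatrices may be exchanged for the full
    matrices.\<close>
  have "restrict_vec ?J Z' = submatrix (Amat G k t) ?J ?I *\<^sub>v restrict_vec ?I Z
      + submatrix (Bmat G k t) ?J UNIV *\<^sub>v restrict_vec UNIV (u k t)"
    using trajectory_step(1)[OF H, of k t] k unfolding truncated_simps Zr Z'r restrict_vec_UNIV by simp
  also have "\<dots> = restrict_vec ?J (Amat G k t *\<^sub>v Z) + restrict_vec ?J (Bmat G k t *\<^sub>v u k t)"
    using submatrix_mult_restrict_vec[OF c(1) Zc Z0, of ?I ?J]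
      submatrix_mult_restrict_vec[OF c(2) u, of UNIV ?J] by simp
  also have "\<dots> = restrict_vec ?J (Amat G k t *\<^sub>v Z + Bmat G k t *\<^sub>v u k t)"
    by (rule restrict_vec_add[OF mult_mat_vec_carrier[OF c(1) Zc] mult_mat_vec_carrier[OF c(2) u], symmetric])
  finally have restr: "restrict_vec ?J Z' = restrict_vec ?J (Amat G k t *\<^sub>v Z + Bmat G k t *\<^sub>v u k t)" .
  have Z'eq: "Z' $ l = (if l \<in> ?J then (Amat G k t *\<^sub>v Z + Bmat G k t *\<^sub>v u k t) $ l else 0)"
    if l: "l < sum_list (map (n (t + 1)) ?o)" for l
  proof (cases "l \<in> ?J")
    case True
    have "Amat G k t *\<^sub>v Z + Bmat G k t *\<^sub>v u k t \<in> carrier_vec (sum_list (map (n (t + 1)) ?o))"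
      by (rule add_carrier_vec[OF mult_mat_vec_carrier[OF c(1) Zc] mult_mat_vec_carrier[OF c(2) u]])
    from restrict_vec_rank[OF this l True] show ?thesis
      unfolding restr[symmetric] restrict_vec_rank[OF Z'c l True] using True by simp
  next
    case False
    then show ?thesis using Z'0 l by simp
  qed
  have "w k t = submatrix (Cmat G k t) UNIV ?I *\<^sub>v restrict_vec ?I Z + Dmat G k t *\<^sub>v u k t"
    using trajectory_step(2)[OF H, of k t] k unfolding truncated_simps Zr by simp
  also have "submatrix (Cmat G k t) UNIV ?I *\<^sub>v restrict_vec ?I Z = Cmat G k t *\<^sub>v Z"
    using submatrix_mult_restrict_vec[OF c(3) Zc Z0, of ?I UNIV] by (simp add: restrict_vec_UNIV)
  finally have "w k t = Cmat G k t *\<^sub>v Z + Dmat G k t *\<^sub>v u k t" .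
  moreover have "y k t = Cmat G k t *\<^sub>v X + Dmat G k t *\<^sub>v u k t"
    unfolding X_def x_def by (rule trajectory_step[OF G k])
  \<comment> \<open>Truncation leaves the feedthrough matrix unchanged, so its contribution
    cancels.\<close>
  ultimately have err: "y k t - w k t = Cmat G k t *\<^sub>v (X - Z)"
    unfolding mult_minus_distrib_mat_vec[OF c(3) Xc Zc] using c u Xc Zc by (intro eq_vecI) auto
  have Wp: "0 < W $ l \<and> W $ l \<le> c" if "l < sum_list (map (n t) ?i)" for l
    unfolding W_def using d_carrier d_pos r_le i that
    by (intro vconcat_index_property[where P = "\<lambda>_ x. 0 < x \<and> x \<le> c" and n = "n t" and r = "r t"]) auto
  have W'p: "0 < W' $ l \<and> W' $ l \<le> c" if "l < sum_list (map (n (t + 1)) ?o)" for l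
    unfolding W'_def using d_carrier d_pos r_le o that
    by (intro vconcat_index_property[where P = "\<lambda>_ x. 0 < x \<and> x \<le> c" and n = "n (t + 1)"
          and r = "r (t + 1)"]) auto
  have W'1: "l \<notin> ?J \<longrightarrow> W' $ l = 1" if "l < sum_list (map (n (t + 1)) ?o)" for l
    unfolding W'_def using d_carrier d_one r_le o that
    by (intro vconcat_index_property[where P = "\<lambda>b x. \<not> b \<longrightarrow> x = 1"]) auto
  have "storage W' X' Z' + (Cmat G k t *\<^sub>v (X - Z)) \<bullet> (Cmat G k t *\<^sub>v (X - Z))
    \<le> storage W X Z + 4 * (1 - \<beta> / c) * (u k t \<bullet> u k t)"
  proof (rule truncation_step[OF c(1-3) Wc _ W'c W'p \<beta> _ _ Xc Zc u X'eq Z'eq])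
    fix p :: "real vec" assume p: "p \<in> carrier_vec (sum_list (map (n (t + 1)) ?o))"
    show "wsq W (transpose_mat (Amat G k t) *\<^sub>v p)
        + (transpose_mat (Bmat G k t) *\<^sub>v p) \<bullet> (transpose_mat (Bmat G k t) *\<^sub>v p) + \<beta> * (p \<bullet> p) \<le> wsq W' p"
      using reach[OF k, of t] unfolding W_def[symmetric] W'_def[symmetric] out_blocks_sites
      by (rule gramian_quad[OF c(1,2) Wc W'c _ p])
  next
    fix v :: "real vec" assume v: "v \<in> carrier_vec (sum_list (map (n t) ?i))"
    \<comment> \<open>Observability is \<open>gramian_quad\<close> for the transposed matrices, with
      the two weight vectors exchanged.\<close>
    have "wsq W' (Amat G k t *\<^sub>v v) + (Cmat G k t *\<^sub>v v) \<bullet> (Cmat G k t *\<^sub>v v) + \<beta> * (v \<bullet> v) \<le> wsq W v"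
      using gramian_quad[OF AT CT W'c Wc _ v] obs[OF k, of t]
      unfolding W_def[symmetric] W'_def[symmetric] in_blocks_sites transpose_transpose .
    moreover have "0 \<le> \<beta> * (v \<bullet> v)" using \<beta> by (simp add: scalar_prod_self sum_nonneg)
    ultimately show "wsq W' (Amat G k t *\<^sub>v v) + (Cmat G k t *\<^sub>v v) \<bullet> (Cmat G k t *\<^sub>v v) \<le> wsq W v"
      by linarith
  qed (use Wp W'1 in auto)
  moreover have "storage W X Z = (\<Sum>j\<leftarrow>?i. storage (d t j) (x t j) (z t j))"
    unfolding W_def X_def Z_def using x z d_carrier i by (intro storage_vconcat[of _ _ "n t"]) auto
  moreover have "storage W' X' Z' = (\<Sum>j\<leftarrow>?o. storage (d (t + 1) j) (x (t + 1) j) (z (t + 1) j))"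
    unfolding W'_def X'_def Z'_def using x z d_carrier o
    by (intro storage_vconcat[of _ _ "n (t + 1)"]) auto
  ultimately show ?thesis unfolding err by simp
qed

text \<open>Summed over the vertices, the local inequalities regroup by sites and telescope in time,
  from \<open>V 0 = 0\<close> to \<open>V T\<close>, which is nonnegative. The horizon is finite
  because summability of the error is not yet known.\<close>

lemma energy_bound:
  assumes u: "u \<in> signals (verts G) (udim G)"
    and G: "trajectory G u xT xS y" and H: "trajectory H u zT zS w"
  shows "(\<Sum>t<T. \<Sum>k\<in>verts G. (y k t - w k t) \<bullet> (y k t - w k t))
    \<le> 4 * (1 - \<beta> / c) * (\<Sum>t<T. \<Sum>k\<in>verts G. u k t \<bullet> u k t)"
proof -
  define V where
    "V t = (\<Sum>j\<in>sites G. storage (d t j) (block xT xS t j) (pad (n t j) (block zT zS t j)))" for t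
  have E: "edges G \<subseteq> verts G \<times> verts G" using dims by (simp add: dims_ok_def)
  have step: "V (t + 1) + (\<Sum>k\<in>verts G. (y k t - w k t) \<bullet> (y k t - w k t))
    \<le> V t + 4 * (1 - \<beta> / c) * (\<Sum>k\<in>verts G. u k t \<bullet> u k t)" for t
  proof -
    let ?s = "\<lambda>t j. storage (d t j) (block xT xS t j) (pad (n t j) (block zT zS t j))"
    have "(\<Sum>k\<in>verts G. (\<Sum>j\<leftarrow>out_sites G k. ?s (t + 1) j) + (y k t - w k t) \<bullet> (y k t - w k t))
      \<le> (\<Sum>k\<in>verts G. (\<Sum>j\<leftarrow>in_sites G k. ?s t j) + 4 * (1 - \<beta> / c) * (u k t \<bullet> u k t))"
      using u by (intro sum_mono vertex_dissipation[OF _ _ G H]) (auto simp: signals_def)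
    then show ?thesis
      unfolding sum.distrib sum_out_sites[OF E] sum_in_sites[OF E] V_def sum_distrib_left .
  qed
  have "V 0 = 0"
    unfolding V_def
  proof (rule sum.neutral, rule ballI)
    fix j assume j: "j \<in> sites G"
    have "block xT xS 0 j = 0\<^sub>v (n 0 j)" by (rule trajectory_zero[OF G j])
    moreover have "block zT zS 0 j = 0\<^sub>v (r 0 j)"
      using trajectory_zero[OF H] j by (simp add: truncated_simps)
    ultimately show "storage (d 0 j) (block xT xS 0 j) (pad (n 0 j) (block zT zS 0 j)) = 0"
      using d_carrier[OF j, of 0] by (auto simp: storage_def pad_index[OF zero_carrier_vec] intro!: sum.neutral)
  qed
  have sum: "V T + (\<Sum>t<T. \<Sum>k\<in>verts G. (y k t - w k t) \<bullet> (y k t - w k t))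
    \<le> 4 * (1 - \<beta> / c) * (\<Sum>t<T. \<Sum>k\<in>verts G. u k t \<bullet> u k t)" for T
  proof (induction T)
    case 0
    show ?case using \<open>V 0 = 0\<close> by simp
  next
    case (Suc T)
    then show ?case using step[of T] by (simp add: algebra_simps)
  qed
  have "0 \<le> d T j $ i" if "j \<in> sites G" "i < dim_vec (d T j)" for i j
    using d_pos[OF that(1), of i T] that(2) d_carrier[OF that(1), of T] by simp
  then have "0 \<le> V T"
    unfolding V_def storage_def
    by (intro sum_nonneg add_nonneg_nonneg mult_nonneg_nonneg divide_nonneg_nonneg) auto
  with sum[of T] show ?thesis by linarith
qed

end

section \<open>From finite horizons to the induced norm\<close>

text \<open>Summability of the energy of \<open>e\<close> is part of the claim, since
  \<open>l2norm\<close> is infinite without it. It follows because the finite-horizon bounds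
  dominate every finite partial sum.\<close>

lemma l2norm_le:
  assumes V: "finite V" and K: "0 \<le> K" and u: "l2norm V u < \<infinity>"
    and le: "\<And>T. (\<Sum>t<T. \<Sum>k\<in>V. e k t \<bullet> e k t) \<le> K\<^sup>2 * (\<Sum>t<T. \<Sum>k\<in>V. u k t \<bullet> u k t)"
  shows "l2norm V e \<le> ennreal K * l2norm V u"
proof -
  define f where "f = (\<lambda>(t, k). u k t \<bullet> u k t)"
  define g where "g = (\<lambda>(t, k). e k t \<bullet> e k t)"
  have f0: "0 \<le> f x" and g0: "0 \<le> g x" for x
    by (auto simp: f_def g_def scalar_prod_self case_prod_beta intro!: sum_nonneg)
  have f: "f summable_on UNIV \<times> V" using u by (auto simp: l2norm_def f_def split: if_splits)
  have bound: "sum g F \<le> K\<^sup>2 * infsum f (UNIV \<times> V)" if F: "finite F" "F \<subseteq> UNIV \<times> V" for F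
  proof -
    \<comment> \<open>A finite set of pairs of time and vertex lies within some finite
      horizon.\<close>
    obtain T where T: "\<And>t. t \<in> fst ` F \<Longrightarrow> t < T"
      using finite_nat_set_iff_bounded[of "fst ` F"] F(1) by auto
    have "sum g F \<le> sum g ({..<T} \<times> V)"
      using F T V g0 by (intro sum_mono2) force+
    also have "\<dots> \<le> K\<^sup>2 * sum f ({..<T} \<times> V)"
      using le[of T] by (simp add: f_def g_def sum.cartesian_product)
    also have "\<dots> \<le> K\<^sup>2 * infsum f (UNIV \<times> V)"
      using V f0 by (intro mult_left_mono finite_sum_le_infsum[OF f]) auto
    finally show ?thesis .
  qed
  have g: "g summable_on UNIV \<times> V"
    using g0 bound
    by (intro nonneg_bdd_above_summable_on bdd_aboveI[of _ "K\<^sup>2 * infsum f (UNIV \<times> V)"]) auto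
  have "infsum g (UNIV \<times> V) \<le> K\<^sup>2 * infsum f (UNIV \<times> V)"
    using bound by (intro infsum_le_finite_sums[OF g])
  then have "sqrt (infsum g (UNIV \<times> V)) \<le> K * sqrt (infsum f (UNIV \<times> V))"
    using K by (metis real_sqrt_abs abs_of_nonneg real_sqrt_le_mono real_sqrt_mult)
  then have "ennreal (sqrt (infsum g (UNIV \<times> V))) \<le> ennreal K * ennreal (sqrt (infsum f (UNIV \<times> V)))"
    using K by (simp add: ennreal_mult'[symmetric] ennreal_leI)
  then show ?thesis using f g by (simp add: l2norm_def f_def g_def)
qed

context unit_truncation
begin

text \<open>Strict inequalities for the individual inputs would not survive the supremum; a common
  bound strictly below 2 does.\<close>

lemma sys_norm_bound:
  "sys_norm (verts G) (udim G) (error_map G H) \<le> ennreal (2 * sqrt (1 - \<beta> / c))"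
  unfolding sys_norm_def
proof (rule SUP_least, clarify)
  fix u e k t
  assume "(u, e) \<in> error_map G H" and u: "u \<in> ell2 (verts G) (udim G)"
  then obtain y w where e: "e = (\<lambda>k t. y k t - w k t)"
    and io: "(u, y) \<in> io_map G" "(u, w) \<in> io_map H"
    by (auto simp: error_map_def)
  from io obtain xT xS zT zS where
    traj: "trajectory G u xT xS y" "trajectory H u zT zS w" by (auto simp: io_map_def)
  let ?K = "2 * sqrt (1 - \<beta> / c)"
  have "0 \<le> 1 - \<beta> / c" using \<beta> by simp
  then have K: "0 \<le> ?K" "?K\<^sup>2 = 4 * (1 - \<beta> / c)" by (simp_all add: power_mult_distrib)
  have "u \<in> signals (verts G) (udim G)" "l2norm (verts G) u < \<infinity>" using u by (auto simp: ell2_def)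
  with energy_bound[OF _ traj] K have le: "l2norm (verts G) e \<le> ennreal ?K * l2norm (verts G) u"
    unfolding e by (intro l2norm_le finite_verts) simp_all
  show "l2norm (verts G) e / l2norm (verts G) u \<le> ennreal ?K"
  proof (cases "l2norm (verts G) u = 0")
    \<comment> \<open>Here \<open>le\<close> forces the error to have norm 0 as well, and 0 divided
      by 0 is 0 in \<open>ennreal\<close>.\<close>
    case True
    with le show ?thesis by simp
  next
    case False
    with le show ?thesis by (intro divide_le_posI_ennreal) (auto simp: mult.commute zero_less_iff_neq_zero)
  qed
qed

lemma sys_norm_less: "sys_norm (verts G) (udim G) (error_map G H) < 2"
proof -
  have "sqrt (1 - \<beta> / c) < 1" using \<beta> by simp
  then have "ennreal (2 * sqrt (1 - \<beta> / c)) < ennreal 2" by (intro ennreal_lessI) auto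
  also have "ennreal 2 = 2" by simp
  finally show ?thesis using sys_norm_bound by (rule le_less_trans[rotated])
qed

end

section \<open>Balanced gramians as an instance of the locale\<close>

text \<open>A diagonal entry is one component of the image of a unit vector, so the operator norm
  bounds it.\<close>

lemma unif_bounded_diag:
  assumes "unif_bounded F"
  shows "\<exists>M. \<forall>t. \<forall>i < min (dim_row (F t)) (dim_col (F t)). F t $$ (i, i) \<le> M"
proof -
  obtain M where M: "\<And>t v. v \<in> carrier_vec (dim_col (F t)) \<Longrightarrow> vnorm (F t *\<^sub>v v) \<le> M * vnorm v"
    using assms by (auto simp: unif_bounded_def)
  have "F t $$ (i, i) \<le> M" if i: "i < dim_row (F t)" "i < dim_col (F t)" for t i
  proof -
    let ?v = "F t *\<^sub>v unit_vec (dim_col (F t)) i"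
    have vi: "?v $ i = F t $$ (i, i)" using i by simp
    have "(?v $ i)\<^sup>2 \<le> ?v \<bullet> ?v"
      unfolding scalar_prod_self using i by (intro member_le_sum) auto
    then have "?v $ i \<le> vnorm ?v" unfolding vnorm_def by (rule real_le_rsqrt)
    also have "\<dots> \<le> M * vnorm (unit_vec (dim_col (F t)) i)" by (rule M) simp
    also have "vnorm (unit_vec (dim_col (F t)) i) = 1" using i by (simp add: vnorm_def)
    finally show ?thesis using vi by simp
  qed
  then show ?thesis by auto
qed

text \<open>Compare the two quadratic forms at a unit vector.\<close>

lemma dvec_lower_bound:
  assumes S: "S \<in> carrier_mat n n" "diagonal_mat S" and \<beta>: "\<beta> \<cdot>\<^sub>m 1\<^sub>m n \<prec>\<^sub>L S" and i: "i < n"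
  shows "\<beta> \<le> dvec S $ i"
proof -
  have v: "unit_vec n i \<in> carrier_vec n" by simp
  have d: "dvec S \<in> carrier_vec n" using S by (auto simp: dvec_def)
  have "\<beta> = unit_vec n i \<bullet> ((\<beta> \<cdot>\<^sub>m 1\<^sub>m n) *\<^sub>v unit_vec n i)"
    unfolding quad_smult_one[OF v] using i by simp
  also have "\<dots> \<le> unit_vec n i \<bullet> (S *\<^sub>v unit_vec n i)"
    by (rule loewner_less_quad[OF \<beta> smult_carrier_mat[OF one_carrier_mat] S(1) v])
  also have "\<dots> = wsq (dvec S) (unit_vec n i)"
    using quad_dmat[OF d v] unfolding dmat_dvec[OF S] .
  also have "\<dots> = (\<Sum>j<n. if j = i then dvec S $ j else 0)"
    unfolding wsq_def using d i by (intro sum.cong) (simp_all add: unit_vec_def)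
  also have "\<dots> = dvec S $ i" using i by simp
  finally show ?thesis .
qed

theorem theorem1:
  fixes G :: dsys
    and SigmaT GammaT OmegaT :: "nat \<Rightarrow> nat \<Rightarrow> real mat"
    and SigmaS GammaS OmegaS :: "nat \<times> nat \<Rightarrow> nat \<Rightarrow> real mat"
    and rT :: "nat \<Rightarrow> nat \<Rightarrow> nat"
    and rS :: "nat \<times> nat \<Rightarrow> nat \<Rightarrow> nat"
  assumes "distributed_system G"
    and "balanced_gramians G SigmaT SigmaS"
    and "\<And>k t. k \<in> verts G \<Longrightarrow> rT k t \<le> tdim G k t"
    and "\<And>e t. e \<in> edges G \<Longrightarrow> rS e t \<le> sdim G e t"
    and "\<And>k t. k \<in> verts G \<Longrightarrow>
           GammaT k t \<in> carrier_mat (rT k t) (rT k t) \<and>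
           OmegaT k t \<in> carrier_mat (tdim G k t - rT k t) (tdim G k t - rT k t) \<and>
           SigmaT k t = diag_block_mat [GammaT k t, OmegaT k t]"
    and "\<And>e t. e \<in> edges G \<Longrightarrow>
           GammaS e t \<in> carrier_mat (rS e t) (rS e t) \<and>
           OmegaS e t \<in> carrier_mat (sdim G e t - rS e t) (sdim G e t - rS e t) \<and>
           SigmaS e t = diag_block_mat [GammaS e t, OmegaS e t]"
    and "\<And>k t. k \<in> verts G \<Longrightarrow> OmegaT k t = 1\<^sub>m (tdim G k t - rT k t)"
    and "\<And>e t. e \<in> edges G \<Longrightarrow> OmegaS e t = 1\<^sub>m (sdim G e t - rS e t)"
  shows "sys_norm (verts G) (udim G) (error_map G (truncate_sys G rT rS)) < 2"
proof -
  let ?S = "block SigmaT SigmaS" and ?n = "block (tdim G) (sdim G)" and ?r = "block rT rS"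
  let ?d = "\<lambda>t j. dvec (?S t j)"
  have dims: "dims_ok G" using assms(1) by (simp add: distributed_system_def)
  then have E: "edges G \<subseteq> verts G \<times> verts G" by (simp add: dims_ok_def)
  have fin: "finite (sites G)" using finite_verts finite_edges[OF E] by (simp add: sites_def)
  from assms(2) obtain \<beta> where \<beta>: "\<beta> > 0"
    and ST: "\<forall>k \<in> verts G. \<forall>t. SigmaT k t \<in> carrier_mat (tdim G k t) (tdim G k t) \<and>
        diagonal_mat (SigmaT k t) \<and> decreasing_diag (SigmaT k t) \<and>
        \<beta> \<cdot>\<^sub>m 1\<^sub>m (tdim G k t) \<prec>\<^sub>L SigmaT k t"
    and SS: "\<forall>e \<in> edges G. \<forall>t. SigmaS e t \<in> carrier_mat (sdim G e t) (sdim G e t) \<and>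
        diagonal_mat (SigmaS e t) \<and> decreasing_diag (SigmaS e t) \<and>
        \<beta> \<cdot>\<^sub>m 1\<^sub>m (sdim G e t) \<prec>\<^sub>L SigmaS e t"
    and bT: "\<forall>k \<in> verts G. unif_bounded (SigmaT k)"
    and bS: "\<forall>e \<in> edges G. unif_bounded (SigmaS e)"
    and lmi0: "\<forall>k \<in> verts G. \<forall>t.
        Amat G k t * diag_block_mat (in_blocks G SigmaT SigmaS k t) * transpose_mat (Amat G k t)
          - diag_block_mat (out_blocks G SigmaT SigmaS k (t + 1))
          + Bmat G k t * transpose_mat (Bmat G k t)
        \<prec>\<^sub>L (- \<beta>) \<cdot>\<^sub>m 1\<^sub>m (out_dim G k (t + 1)) \<and>
        transpose_mat (Amat G k t) * diag_block_mat (out_blocks G SigmaT SigmaS k (t + 1)) * Amat G k t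
          - diag_block_mat (in_blocks G SigmaT SigmaS k t)
          + transpose_mat (Cmat G k t) * Cmat G k t
        \<prec>\<^sub>L (- \<beta>) \<cdot>\<^sub>m 1\<^sub>m (in_dim G k t)"
    unfolding balanced_gramians_def by (elim exE conjE) (rule that)
  note lmi = lmi0[rule_format]
  have S: "?S t j \<in> carrier_mat (?n t j) (?n t j) \<and> diagonal_mat (?S t j) \<and>
      \<beta> \<cdot>\<^sub>m 1\<^sub>m (?n t j) \<prec>\<^sub>L ?S t j" if "j \<in> sites G" for t j
    using that ST SS by (cases j) (simp_all add: sites_def block_def image_iff)
  have bdd: "unif_bounded (\<lambda>t. ?S t j)" if "j \<in> sites G" for j
    using that bT bS by (cases j) (simp_all add: sites_def block_def image_iff)
  have diag: "diag_block_mat (map (?S t) js) = dmat (vconcat (map (?d t) js))"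
    if "\<And>j. j \<in> set js \<Longrightarrow> j \<in> sites G" for js t
  proof -
    have "map (?S t) js = map dmat (map (?d t) js)"
      using that dmat_dvec[OF conjunct1[OF S] conjunct1[OF conjunct2[OF S]]] by simp
    then show ?thesis by (simp only: diag_block_mat_dmat)
  qed
  have "\<exists>M. \<forall>t. \<forall>i < ?n t j. ?S t j $$ (i, i) \<le> M" if j: "j \<in> sites G" for j
    using unif_bounded_diag[OF bdd[OF j]] carrier_matD[OF conjunct1[OF S[OF j]]] by simp
  then have "\<forall>j\<in>sites G. \<exists>M. \<forall>t. \<forall>i < ?n t j. ?S t j $$ (i, i) \<le> M" ..
  then obtain M where M: "\<forall>j\<in>sites G. \<forall>t. \<forall>i < ?n t j. ?S t j $$ (i, i) \<le> M j"
    by (rule bchoice[THEN exE])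
  \<comment> \<open>There are finitely many sites, so the sum dominates each bound
    \<open>M j\<close>; the summand \<open>1 + \<beta>\<close> ensures \<open>\<beta> < c\<close>,
    even for an empty graph.\<close>
  define c where "c = 1 + \<beta> + (\<Sum>j\<in>sites G. \<bar>M j\<bar>)"
  have "0 \<le> (\<Sum>j\<in>sites G. \<bar>M j\<bar>)" by (rule sum_nonneg) simp
  \<comment> \<open>An index \<open>i\<close> with \<open>r \<le> i\<close> falls into the lower
    right block, which is where the condition on the truncated blocks enters.\<close>
  have one: "diag_block_mat [A, 1\<^sub>m (n - r)] $$ (i, i) = 1"
    if "A \<in> carrier_mat r r" "r \<le> i" "i < n" for A :: "real mat" and n r i
    using that by (simp add: Let_def)
  have "\<beta> < c" using \<open>0 \<le> (\<Sum>j\<in>sites G. \<bar>M j\<bar>)\<close> unfolding c_def by linarith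
  have r_le: "?r t j \<le> ?n t j" if "j \<in> sites G" for t j
    using that assms(3,4) by (cases j) (simp_all add: sites_def block_def image_iff)
  have d_carrier: "?d t j \<in> carrier_vec (?n t j)" if "j \<in> sites G" for t j
    using carrier_matD(1)[OF conjunct1[OF S[OF that]]] by (intro carrier_vecI) (simp only: dvec_def dim_vec)
  have d_index: "?d t j $ i = ?S t j $$ (i, i)" if "j \<in> sites G" "i < ?n t j" for t j i
    using carrier_matD[OF conjunct1[OF S[OF that(1), of t]]] that(2) by (simp add: dvec_def)
  have d_pos: "0 < ?d t j $ i \<and> ?d t j $ i \<le> c" if j: "j \<in> sites G" and i: "i < ?n t j" for t j i
  proof -
    have "\<beta> \<le> ?d t j $ i"
      using S[OF j, of t] i by (intro dvec_lower_bound[of _ "?n t j"]) simp_all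
    moreover have "\<bar>M j\<bar> \<le> (\<Sum>j\<in>sites G. \<bar>M j\<bar>)"
      using j fin by (intro member_le_sum) auto
    moreover have "?d t j $ i \<le> M j" using M j i d_index[OF j i] by simp
    ultimately show ?thesis using \<beta> unfolding c_def by linarith
  qed
  have d_one: "?d t j $ i = 1" if j: "j \<in> sites G" and i: "?r t j \<le> i" "i < ?n t j" for t j i
  proof (cases j)
    case (Inl k)
    then have k: "k \<in> verts G" "rT k t \<le> i" "i < tdim G k t" using j i by (auto simp: sites_def block_def)
    have "?S t j = diag_block_mat [GammaT k t, 1\<^sub>m (tdim G k t - rT k t)]"
      using assms(5)[OF k(1)] assms(7)[OF k(1)] Inl by (metis block_def sum.case(1))
    then show ?thesis unfolding d_index[OF j i(2)] using one assms(5)[OF k(1)] k by metis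
  next
    case (Inr e)
    then have e: "e \<in> edges G" "rS e t \<le> i" "i < sdim G e t" using j i by (auto simp: sites_def block_def)
    have "?S t j = diag_block_mat [GammaS e t, 1\<^sub>m (sdim G e t - rS e t)]"
      using assms(6)[OF e(1)] assms(8)[OF e(1)] Inr by (metis block_def sum.case(2))
    then show ?thesis unfolding d_index[OF j i(2)] using one assms(6)[OF e(1)] e by metis
  qed
  have reach: "Amat G k t * dmat (vconcat (map (?d t) (in_sites G k))) * transpose_mat (Amat G k t)
        - dmat (vconcat (map (?d (t + 1)) (out_sites G k))) + Bmat G k t * transpose_mat (Bmat G k t)
      \<prec>\<^sub>L (- \<beta>) \<cdot>\<^sub>m 1\<^sub>m (out_dim G k (t + 1))"
    and obs: "transpose_mat (Amat G k t) * dmat (vconcat (map (?d (t + 1)) (out_sites G k))) * Amat G k t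
        - dmat (vconcat (map (?d t) (in_sites G k))) + transpose_mat (Cmat G k t) * Cmat G k t
      \<prec>\<^sub>L (- \<beta>) \<cdot>\<^sub>m 1\<^sub>m (in_dim G k t)" if k: "k \<in> verts G" for k t
  proof -
    have i: "diag_block_mat (in_blocks G SigmaT SigmaS k t) = dmat (vconcat (map (?d t) (in_sites G k)))" for t
      unfolding in_blocks_sites by (rule diag) (rule in_sites_subset[OF k])
    have o: "diag_block_mat (out_blocks G SigmaT SigmaS k t) = dmat (vconcat (map (?d t) (out_sites G k)))" for t
      unfolding out_blocks_sites by (rule diag) (rule out_sites_subset[OF k])
    note b = lmi[OF k, of t, unfolded i o]
    show "Amat G k t * dmat (vconcat (map (?d t) (in_sites G k))) * transpose_mat (Amat G k t)
        - dmat (vconcat (map (?d (t + 1)) (out_sites G k))) + Bmat G k t * transpose_mat (Bmat G k t)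
      \<prec>\<^sub>L (- \<beta>) \<cdot>\<^sub>m 1\<^sub>m (out_dim G k (t + 1))" by (rule conjunct1[OF b])
    show "transpose_mat (Amat G k t) * dmat (vconcat (map (?d (t + 1)) (out_sites G k))) * Amat G k t
        - dmat (vconcat (map (?d t) (in_sites G k))) + transpose_mat (Cmat G k t) * Cmat G k t
      \<prec>\<^sub>L (- \<beta>) \<cdot>\<^sub>m 1\<^sub>m (in_dim G k t)" by (rule conjunct2[OF b])
  qed
  have "unit_truncation G rT rS ?d \<beta> c"
    by (rule unit_truncation.intro[OF dims r_le d_carrier d_pos d_one \<beta> \<open>\<beta> < c\<close> reach obs])
  then show ?thesis by (rule unit_truncation.sys_norm_less)
qed

end
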